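(* Let $h$ be a collision-resistant hash function. Then the TrollThrottle protocol, built from an instantly linkable direct anonymous attestation scheme $\mathsf{DAA}$, the hash function $h$ and a non-interactive proof of knowledge system for the relation $\mathcal{R}_{\mathsf{Join}}$, has a sound accountability mechanism: for every probabilistic polynomial-time (PPT) adversary $\mathcal{A}$, the probability $\Pr[\mathsf{Exp}^{\mathsf{accsound}}_{\mathcal{A}}(1^\lambda)=1]$ is negligible in $\lambda$.
   Context: **DAA schemes.** A direct anonymous attestation (DAA) scheme consists of PPT algorithms and a protocol: $\mathsf{Setup}_{\mathsf{DAA}}(1^\lambda)$ outputs an issuer key pair $(\mathit{pk}_I,\mathit{sk}_I)$. In the protocol $\mathsf{Join\text{-}Issue}_{\mathsf{DAA}}$ a signer $S$ with secret key $\mathit{sk}_S$ computes $\mathsf{com}\leftarrow\mathsf{Join}_{\mathsf{DAA}}(\mathit{pk}_I,\mathit{sk}_S)$ and the issuer answers with a credential $\mathit{cred}_S\leftarrow\mathsf{Issue}_{\mathsf{DAA}}(\mathit{sk}_I,\mathsf{com})$. $\mathsf{Sign}_{\mathsf{DAA}}(\mathit{sk}_S,\mathit{cred}_S,\mathit{dom},m)$ outputs a signature $\sigma$ on $m$ w.r.t. basename $\mathit{dom}$. The deterministic $\mathsf{Verify}_{\mathsf{DAA}}(\mathit{pk}_I,m,\mathit{dom},\sigma,RL)\in\{0,1\}$ checks validity w.r.t. a list $RL$ of revoked secret keys; $RL_\emptyset$ is the empty list. $\mathsf{Link}_{\mathsf{DAA}}(\sigma_0,\sigma_1)$ decides whether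 two signatures are linked. Instant linkability provides in particular deterministic poly-time algorithms $\mathsf{NymGen},\mathsf{NymExtract}$ with $\mathsf{NymGen}(\mathit{sk}_S,\mathit{dom})=\mathsf{NymExtract}(\mathsf{Sign}_{\mathsf{DAA}}(\mathit{sk}_S,\mathit{cred},\mathit{dom},\cdot))$, such that valid signatures are linked iff their extracted nyms are equal, and a poly-time algorithm $\mathsf{VerifyBsn}(\sigma,\mathit{dom})\in\{0,1\}$ checking that $\mathit{dom}$ is the (computationally unique) basename of $\sigma$. **Proof system.** A non-interactive proof system has algorithms $\mathsf{Setup}_{\mathsf{ZK}}(1^\lambda)\to\rho$, $\mathsf{CreateProof}(\rho,x,w)\to\pi$, $\mathsf{VerifyProof}(\rho,x,\pi)\in\{0,1\}$. The relation is $((\mathsf{com},\mathit{pk}_I),\mathit{sk}_S)\in\mathcal{R}_{\mathsf{Join}}$ iff $\mathsf{com}$ is an output of $\mathsf{Join}_{\mathsf{DAA}}(\mathit{pk}_I,\mathit{sk}_S)$ (the witness also contains the random coins). **TrollThrottle.** - $\mathsf{Setup}(1^\lambda)$: $\rho_{\mathsf{Join}}\leftarrow\mathsf{Setup}_{\mathsf{ZK}}(1^\lambda)$; output $\rho=(1^\lambda,\rho_{\mathsf{Join}})$. - $\mathsf{KeyGen}(\rho)$: run $\mathsf{Setup}_{\mathsf{DAA}}(1^\lambda)$; $\mathit{pk}_{\mathsf I}$ is the DAA issuer public key, $\mathit{sk}_{\mathsf I}$ the DAA issuer key pair. - $\mathsf{Join}(\mathit{pk}_{\mathsf I},\mathit{sk}_U,U)$: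 $\mathsf{com}\leftarrow\mathsf{Join}_{\mathsf{DAA}}(\mathit{pk}_{\mathsf I},\mathit{sk}_U)$; $\Pi_{\mathsf{Join}}=\mathsf{CreateProof}(\rho_{\mathsf{Join}},(\mathsf{com},\mathit{pk}_{\mathsf I}),\mathit{sk}_U)$; send $(\mathsf{com},\Pi_{\mathsf{Join}})$, receive $\mathit{cred}_U$, return $(\mathit{cred}_U,\mathit{sk}_U)$. - $\mathsf{Issue}(\mathit{sk}_{\mathsf I},\mathit{ver},U)$ (for a user that has not registered so far): receive $(\mathsf{com},\Pi_{\mathsf{Join}})$, abort if the proof is invalid, else send $\mathit{cred}_U\leftarrow\mathsf{Issue}_{\mathsf{DAA}}(\mathit{sk}_{\mathsf I},\mathsf{com})$. - $\mathsf{Comment}(\mathit{pk}_{\mathsf I},\mathit{sk}_U,\mathit{cred}_U,\mathit{dom},m)$: $\sigma\leftarrow\mathsf{Sign}_{\mathsf{DAA}}(\mathit{sk}_U,\mathit{cred}_U,\mathit{dom},h(m))$, $\mathit{nym}=\mathsf{NymGen}(\mathit{sk}_U,\mathit{dom})=\mathsf{NymExtract}(\sigma)$; output $\mathit{nym}$ and $\gamma=(\sigma,\mathit{nym},\mathit{dom},h(m))$. - $\mathsf{Verify}(\mathit{pk}_{\mathsf I},\mathit{nym},\mathit{dom},m,\gamma)$: parse $\gamma=(\sigma,\mathit{nym},\mathit{dom},h^* )$ (with the given $\mathit{nym},\mathit{dom}$); output $1$ iff $\mathsf{Verify}_{\mathsf{DAA}}(\mathit{pk}_{\mathsf I},h^*,\mathit{dom},\sigma,RL_\emptyset)=1$,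 $h(m)=h^*$, $\mathsf{NymExtract}(\sigma)=\mathit{nym}$ and $\mathsf{VerifyBsn}(\sigma,\mathit{dom})=1$. - $\mathsf{Claim}(\mathit{pk}_{\mathsf I},\mathit{sk}_U,\mathit{cred}_U,\mathit{dom},m,\gamma)$: return $\mathit{evidence}=\gamma$. - $\mathsf{VerifyClaim}(\mathit{pk}_{\mathsf I},\mathit{dom},m,\gamma,\mathit{evidence})$: parse $\gamma=(\sigma,\mathit{nym},\mathit{dom},h^* )$ (with the given $\mathit{dom}$) and output $1$ iff $\mathsf{Verify}(\mathit{pk}_{\mathsf I},\mathit{nym},\mathit{dom},m,\gamma)=1$. **Oracles.** Global sets $\mathrm{CU},\mathrm{HU},\mathrm{VM},\mathrm{USK},\mathrm{COMM}$ are initially empty; $\mathit{ver}[V,U]\in\{0,1\}$ is initially $0$. - $\mathsf{CorruptUser}(U)$: if some $(U,\mathit{sk}_U,\mathit{cred}_U,\cdot)\in\mathrm{USK}$ output $(\mathit{sk}_U,\mathit{cred}_U)$, else $\bot$; add $U$ to $\mathrm{CU}$, remove it from $\mathrm{HU}$. - $\mathsf{CorruptVer}(U,V)$: set $\mathit{ver}[V,U]=1$, add $(V,U)$ to $\mathrm{VM}$. - $\mathsf{CreateHonestUser}(U,V)$: return $\bot$ if $U\in\mathrm{HU}\cup\mathrm{CU}$; set $\mathit{ver}[V,U]=1$, run the whole $\mathsf{Join}$–$\mathsf{Issue}$ protocol to get $(\mathit{sk}_U,\mathit{cred}_U)$, add $(U,\mathit{sk}_U,\mathit{cred}_U,V)$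 to $\mathrm{USK}$ and $U$ to $\mathrm{HU}$. - $\mathsf{JoinSystem}(U,V)$: return $\bot$ unless $U\notin\mathrm{HU}\cup\mathrm{CU}$, $\mathit{ver}[V,U]=1$ and $U$ has not already registered through this oracle; otherwise execute $\mathsf{Issue}(\mathit{sk}_{\mathsf I},\mathit{ver},U)$ interactively with the adversary playing the user. - $\mathsf{CreateComment}(U,\mathit{dom},m)$: require $U\in\mathrm{HU}$; compute $(\mathit{nym},\gamma)\leftarrow\mathsf{Comment}(\mathit{pk}_{\mathsf I},\mathit{sk}_U,\mathit{cred}_U,\mathit{dom},m)$, add $(U,\mathit{nym},\mathit{dom},m,\gamma)$ to $\mathrm{COMM}$, output $(\gamma,\mathit{nym})$. **Experiment $\mathsf{Exp}^{\mathsf{accsound}}_{\mathcal{A}}(1^\lambda)$.** Run $\rho\leftarrow\mathsf{Setup}(1^\lambda)$, $(\mathit{pk}_{\mathsf I},\mathit{sk}_{\mathsf I})\leftarrow\mathsf{KeyGen}(\rho)$. Run $\mathcal{A}(\rho,\mathit{pk}_{\mathsf I})$ with oracles $\mathsf{CorruptUser},\mathsf{CreateHonestUser},\mathsf{CorruptVer},\mathsf{CreateComment},\mathsf{JoinSystem}$, obtaining $(\mathit{dom}^*,m^*,\gamma^*,\mathit{evidence}^* )$. Return $1$ if all of the following hold (else $0$): $\mathrm{COMM}$ contains no tuple $(\cdot,\cdot,\mathit{dom}^*,m^*,\cdot)$; $\mathrm{COMM}$ contains a tuple $(\cdot,\cdot,\cdot,\cdot,\gamma^* )$; and $\mathsf{VerifyClaim}(\mathit{pk}_{\mathsf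 I},\mathit{dom}^*,m^*,\gamma^*,\mathit{evidence}^* )=1$. *)

theory Defs
  imports "HOL-Probability.Probability" "HOL-Computational_Algebra.Polynomial"
begin

section \<open>Probabilistic polynomial time\<close>

text \<open>
  Binary trees play the role of strings: bits, strings and tuples all have linear-size encodings
  as trees, and vice versa.
\<close>

datatype data = Leaf | Node data data

class encodable =
  fixes enc :: "'a \<Rightarrow> data"
  assumes inj_enc: "inj enc"

instantiation data :: encodable
begin
definition enc_data :: "data \<Rightarrow> data" where "enc_data x = x"
instance by standard (simp add: inj_on_def enc_data_def)
end

instantiation unit :: encodable
begin
definition enc_unit :: "unit \<Rightarrow> data" where "enc_unit u = Leaf"
instance by standard (simp add: inj_on_def)
end

instantiation bool :: encodable
begin
definition enc_bool :: "bool \<Rightarrow> data" where "enc_bool b = (if b then Node Leaf Leaf else Leaf)"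
instance by standard (simp add: inj_on_def enc_bool_def)
end

text \<open>Numbers are encoded in unary, so \<open>enc \<eta>\<close> is the usual input \<open>1\<close> to the power \<open>\<eta>\<close>.\<close>

instantiation nat :: encodable
begin
primrec enc_nat :: "nat \<Rightarrow> data" where
  "enc_nat 0 = Leaf"
| "enc_nat (Suc n) = Node Leaf (enc_nat n)"
instance
proof
  have "enc m = enc n \<Longrightarrow> m = n" for m n :: nat
  proof (induction m arbitrary: n)
    case 0 then show ?case by (cases n) auto
  next
    case (Suc m) then show ?case by (cases n) auto
  qed
  then show "inj (enc :: nat \<Rightarrow> data)" by (auto simp: inj_on_def)
qed
end

instantiation prod :: (encodable, encodable) encodable
begin
definition enc_prod :: "'a \<times> 'b \<Rightarrow> data" where "enc_prod p = Node (enc (fst p)) (enc (snd p))"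
instance by standard (auto simp: inj_on_def enc_prod_def dest: injD[OF inj_enc])
end

instantiation option :: (encodable) encodable
begin
primrec enc_option :: "'a option \<Rightarrow> data" where
  "enc_option None = Leaf"
| "enc_option (Some x) = Node Leaf (enc x)"
instance
proof
  have "enc x = enc y \<Longrightarrow> x = y" for x y :: "'a option"
    by (cases x; cases y) (auto dest: injD[OF inj_enc])
  then show "inj (enc :: 'a option \<Rightarrow> data)" by (auto simp: inj_on_def)
qed
end

instantiation list :: (encodable) encodable
begin
primrec enc_list :: "'a list \<Rightarrow> data" where
  "enc_list [] = Leaf"
| "enc_list (x # xs) = Node (enc x) (enc_list xs)"
instance
proof
  have "enc xs = enc ys \<Longrightarrow> xs = ys" for xs ys :: "'a list"
  proof (induction xs arbitrary: ys)
    case Nil then show ?case by (cases ys) auto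
  next
    case (Cons x xs) then show ?case by (cases ys) (auto dest: injD[OF inj_enc])
  qed
  then show "inj (enc :: 'a list \<Rightarrow> data)" by (auto simp: inj_on_def)
qed
end

text \<open>
  The machine model is a first-order while language with coin flips and calls to external
  procedures with names in \<open>'o\<close>. Every construct is charged the size of the data it reads and
  creates (so the time bounds the size of the result, despite the copying in \<open>Pair\<close>). Hence it
  simulates probabilistic Turing machines, and is simulated by them, with polynomial overhead:
  a configuration is a tree, a transition is a composition of constant depth of the basic
  constructs, and a run is a single \<open>While\<close>.
\<close>

datatype 'o prog =
    Ident
  | Const data
  | Fst
  | Snd
  | Eq
  | Flip
  | Call 'o
  | Pair "'o prog" "'o prog"
  | Comp "'o prog" "'o prog"
  | Cond "'o prog" "'o prog" "'o prog"
  | While "'o prog" "'o prog"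

fun left :: "data \<Rightarrow> data" where
  "left (Node x y) = x"
| "left Leaf = Leaf"

fun right :: "data \<Rightarrow> data" where
  "right (Node x y) = y"
| "right Leaf = Leaf"

text \<open>
  A computation maps an input and the state of the external procedures to a distribution on
  results, new states and running times; the missing probability mass is the probability of
  divergence.
\<close>

type_synonym 's computation = "data \<Rightarrow> 's \<Rightarrow> (data \<times> 's \<times> nat) spmf"

abbreviation cost :: "data \<Rightarrow> nat" where "cost x \<equiv> Suc (size x)"

partial_function (spmf) while_loop ::
    "'s computation \<Rightarrow> 's computation \<Rightarrow> data \<Rightarrow> 's \<Rightarrow> nat \<Rightarrow> (data \<times> 's \<times> nat) spmf" where
  "while_loop test body x s t =
     bind_spmf (test x s) (\<lambda>(b, s1, t1).
       if b = Leaf then return_spmf (x, s1, t + cost x + t1)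
       else bind_spmf (body x s1) (\<lambda>(y, s2, t2). while_loop test body y s2 (t + cost x + t1 + t2)))"

primrec run :: "('o \<Rightarrow> data \<Rightarrow> 's \<Rightarrow> (data \<times> 's) pmf) \<Rightarrow> 'o prog \<Rightarrow> 's computation" where
  "run H Ident = (\<lambda>x s. return_spmf (x, s, cost x))"
| "run H (Const d) = (\<lambda>x s. return_spmf (d, s, cost x + size d))"
| "run H Fst = (\<lambda>x s. return_spmf (left x, s, cost x))"
| "run H Snd = (\<lambda>x s. return_spmf (right x, s, cost x))"
| "run H Eq = (\<lambda>x s. return_spmf (enc (left x = right x), s, cost x + 1))"
| "run H Flip = (\<lambda>x s. map_spmf (\<lambda>b. (enc b, s, cost x + 1)) (spmf_of_set (UNIV :: bool set)))"
| "run H (Call i) = (\<lambda>x s. map_spmf (\<lambda>(y, s'). (y, s', cost x + size y)) (spmf_of_pmf (H i x s)))"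
| "run H (Pair p q) = (\<lambda>x s.
     bind_spmf (run H p x s) (\<lambda>(y, s1, t1).
     bind_spmf (run H q x s1) (\<lambda>(z, s2, t2).
     return_spmf (Node y z, s2, cost x + t1 + t2))))"
| "run H (Comp p q) = (\<lambda>x s.
     bind_spmf (run H q x s) (\<lambda>(y, s1, t1).
     bind_spmf (run H p y s1) (\<lambda>(z, s2, t2).
     return_spmf (z, s2, cost x + t1 + t2))))"
| "run H (Cond c p q) = (\<lambda>x s.
     bind_spmf (run H c x s) (\<lambda>(b, s1, t1).
     bind_spmf (if b = Leaf then run H q x s1 else run H p x s1) (\<lambda>(y, s2, t2).
     return_spmf (y, s2, cost x + t1 + t2))))"
| "run H (While c p) = (\<lambda>x s. while_loop (run H c) (run H p) x s 0)"

text \<open>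
  The security parameter is an additional unary input of every algorithm. For a stand-alone
  algorithm all calls are answered by \<open>Leaf\<close>, so that they are useless. The time bound holds for
  every outcome of the coin flips.
\<close>

definition ppt :: "(nat \<Rightarrow> 'a::encodable \<Rightarrow> 'b::encodable pmf) \<Rightarrow> bool" where
  "ppt f \<longleftrightarrow> (\<exists>(P :: unit prog) (p :: nat poly). \<forall>\<eta> x.
     let D = run (\<lambda>_ _ s. return_pmf (Leaf, s)) P (enc (\<eta>, x)) ()
     in map_spmf fst D = spmf_of_pmf (map_pmf enc (f \<eta> x)) \<and>
        (\<forall>(y, s, t) \<in> set_spmf D. t \<le> poly p (\<eta> + size (enc x))))"

definition poly_time :: "(nat \<Rightarrow> 'a::encodable \<Rightarrow> 'b::encodable) \<Rightarrow> bool" where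
  "poly_time f \<longleftrightarrow> ppt (\<lambda>\<eta> x. return_pmf (f \<eta> x))"

definition negligible_fun :: "(nat \<Rightarrow> real) \<Rightarrow> bool" where
  "negligible_fun f \<longleftrightarrow> (\<forall>c::nat. eventually (\<lambda>\<eta>. \<bar>f \<eta>\<bar> \<le> 1 / real \<eta> ^ c) sequentially)"


section \<open>Building blocks\<close>

definition collision_resistant :: "(nat \<Rightarrow> data \<Rightarrow> data) \<Rightarrow> bool" where
  "collision_resistant h \<longleftrightarrow> poly_time h \<and>
     (\<forall>B :: nat \<Rightarrow> unit \<Rightarrow> (data \<times> data) pmf. ppt B \<longrightarrow>
        negligible_fun (\<lambda>\<eta>. measure_pmf.prob (B \<eta> ()) {(m, m'). m \<noteq> m' \<and> h \<eta> m = h \<eta> m'}))"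

text \<open>
  \<open>daa_user_key\<close> samples the secret key of an honest signer. The commitment algorithm is split
  into the choice of its random coins and a deterministic part, because the coins belong to the
  witness of the join relation.
\<close>

record daa =
  daa_setup :: "nat \<Rightarrow> (data \<times> data) pmf" \<comment> \<open>issuer public key, issuer secret key\<close>
  daa_user_key :: "nat \<Rightarrow> data \<Rightarrow> data pmf" \<comment> \<open>issuer public key\<close>
  daa_join_coins :: "nat \<Rightarrow> data \<Rightarrow> data pmf" \<comment> \<open>issuer public key\<close>
  daa_join :: "nat \<Rightarrow> data \<Rightarrow> data \<Rightarrow> data \<Rightarrow> data" \<comment> \<open>issuer public key, signer key, coins\<close>
  daa_issue :: "nat \<Rightarrow> data \<Rightarrow> data \<Rightarrow> data pmf" \<comment> \<open>issuer secret key, commitment\<close>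
  daa_sign :: "nat \<Rightarrow> data \<Rightarrow> data \<Rightarrow> data \<Rightarrow> data \<Rightarrow> data pmf"
    \<comment> \<open>signer key, credential, basename, message\<close>
  daa_verify :: "nat \<Rightarrow> data \<Rightarrow> data \<Rightarrow> data \<Rightarrow> data \<Rightarrow> data list \<Rightarrow> bool"
    \<comment> \<open>issuer public key, message, basename, signature, revoked signer keys\<close>
  daa_link :: "nat \<Rightarrow> data \<Rightarrow> data \<Rightarrow> bool"
  nym_gen :: "nat \<Rightarrow> data \<Rightarrow> data \<Rightarrow> data" \<comment> \<open>signer key, basename\<close>
  nym_extract :: "nat \<Rightarrow> data \<Rightarrow> data"
  verify_bsn :: "nat \<Rightarrow> data \<Rightarrow> data \<Rightarrow> bool" \<comment> \<open>signature, basename\<close>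

definition is_daa :: "daa \<Rightarrow> bool" where
  "is_daa D \<longleftrightarrow>
     ppt (\<lambda>\<eta> (_ :: unit). daa_setup D \<eta>) \<and>
     ppt (daa_user_key D) \<and>
     ppt (daa_join_coins D) \<and>
     poly_time (\<lambda>\<eta> (pk, sk, r). daa_join D \<eta> pk sk r) \<and>
     ppt (\<lambda>\<eta> (skI, com). daa_issue D \<eta> skI com) \<and>
     ppt (\<lambda>\<eta> (sk, cred, bsn, m). daa_sign D \<eta> sk cred bsn m) \<and>
     poly_time (\<lambda>\<eta> (pk, m, bsn, \<sigma>, RL). daa_verify D \<eta> pk m bsn \<sigma> RL) \<and>
     poly_time (\<lambda>\<eta> (\<sigma>0, \<sigma>1). daa_link D \<eta> \<sigma>0 \<sigma>1)"

definition instantly_linkable :: "daa \<Rightarrow> bool" where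
  "instantly_linkable D \<longleftrightarrow>
     poly_time (\<lambda>\<eta> (sk, bsn). nym_gen D \<eta> sk bsn) \<and>
     poly_time (nym_extract D) \<and>
     poly_time (\<lambda>\<eta> (\<sigma>, bsn). verify_bsn D \<eta> \<sigma> bsn) \<and>
     (\<forall>\<eta>. \<forall>(pk, skI) \<in> set_pmf (daa_setup D \<eta>). \<forall>sk \<in> set_pmf (daa_user_key D \<eta> pk).
        \<forall>r \<in> set_pmf (daa_join_coins D \<eta> pk).
        \<forall>cred \<in> set_pmf (daa_issue D \<eta> skI (daa_join D \<eta> pk sk r)).
        \<forall>bsn m. \<forall>\<sigma> \<in> set_pmf (daa_sign D \<eta> sk cred bsn m).
          nym_extract D \<eta> \<sigma> = nym_gen D \<eta> sk bsn \<and> verify_bsn D \<eta> \<sigma> bsn) \<and>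
     (\<forall>\<eta>. \<forall>(pk, skI) \<in> set_pmf (daa_setup D \<eta>). \<forall>m0 bsn0 \<sigma>0 RL0 m1 bsn1 \<sigma>1 RL1.
        daa_verify D \<eta> pk m0 bsn0 \<sigma>0 RL0 \<longrightarrow> daa_verify D \<eta> pk m1 bsn1 \<sigma>1 RL1 \<longrightarrow>
        (daa_link D \<eta> \<sigma>0 \<sigma>1 \<longleftrightarrow> nym_extract D \<eta> \<sigma>0 = nym_extract D \<eta> \<sigma>1)) \<and>
     (\<forall>B :: nat \<Rightarrow> unit \<Rightarrow> (data \<times> data \<times> data) pmf. ppt B \<longrightarrow>
        negligible_fun (\<lambda>\<eta>. measure_pmf.prob (B \<eta> ())
          {(\<sigma>, bsn0, bsn1). bsn0 \<noteq> bsn1 \<and> verify_bsn D \<eta> \<sigma> bsn0 \<and> verify_bsn D \<eta> \<sigma> bsn1}))"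

type_synonym statement = "data \<times> data"
type_synonym witness = "data \<times> data"

text \<open>
  Statements are pairs of a commitment and an issuer public key, witnesses are pairs of a signer
  key and random coins.
\<close>

definition R_join :: "daa \<Rightarrow> nat \<Rightarrow> (statement \<times> witness) set" where
  "R_join D \<eta> = {((com, pk), (sk, r)). r \<in> set_pmf (daa_join_coins D \<eta> pk) \<and> com = daa_join D \<eta> pk sk r}"

record nizk =
  zk_setup :: "nat \<Rightarrow> data pmf"
  zk_prove :: "nat \<Rightarrow> data \<Rightarrow> statement \<Rightarrow> witness \<Rightarrow> data pmf"
  zk_verify :: "nat \<Rightarrow> data \<Rightarrow> statement \<Rightarrow> data \<Rightarrow> bool"

text \<open>
  Knowledge extraction in the common reference string model: \<open>E1\<close> generates an indistinguishable
  reference string together with a trapdoor, by means of which \<open>E2\<close> extracts a witness from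
  every accepted proof, except with negligible probability.
\<close>

definition proof_of_knowledge :: "nizk \<Rightarrow> (nat \<Rightarrow> (statement \<times> witness) set) \<Rightarrow> bool" where
  "proof_of_knowledge Z R \<longleftrightarrow>
     ppt (\<lambda>\<eta> (_ :: unit). zk_setup Z \<eta>) \<and>
     ppt (\<lambda>\<eta> (\<rho>, x, w). zk_prove Z \<eta> \<rho> x w) \<and>
     poly_time (\<lambda>\<eta> (\<rho>, x, \<pi>). zk_verify Z \<eta> \<rho> x \<pi>) \<and>
     (\<forall>\<eta>. \<forall>\<rho> \<in> set_pmf (zk_setup Z \<eta>). \<forall>(x, w) \<in> R \<eta>. \<forall>\<pi> \<in> set_pmf (zk_prove Z \<eta> \<rho> x w).
        zk_verify Z \<eta> \<rho> x \<pi>) \<and>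
     (\<exists>(E1 :: nat \<Rightarrow> unit \<Rightarrow> (data \<times> data) pmf)
       (E2 :: nat \<Rightarrow> data \<times> data \<times> statement \<times> data \<Rightarrow> witness pmf).
        ppt E1 \<and> ppt E2 \<and>
        (\<forall>B :: nat \<Rightarrow> data \<Rightarrow> bool pmf. ppt B \<longrightarrow>
           negligible_fun (\<lambda>\<eta>. pmf (bind_pmf (zk_setup Z \<eta>) (B \<eta>)) True
                          - pmf (bind_pmf (E1 \<eta> ()) (\<lambda>(\<rho>, \<tau>). B \<eta> \<rho>)) True)) \<and>
        (\<forall>B :: nat \<Rightarrow> data \<Rightarrow> (statement \<times> data) pmf. ppt B \<longrightarrow>
           negligible_fun (\<lambda>\<eta>. pmf (bind_pmf (E1 \<eta> ()) (\<lambda>(\<rho>, \<tau>).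
                                bind_pmf (B \<eta> \<rho>) (\<lambda>(x, \<pi>).
                                bind_pmf (E2 \<eta> (\<rho>, \<tau>, x, \<pi>)) (\<lambda>w.
                                return_pmf (zk_verify Z \<eta> \<rho> x \<pi> \<and> (x, w) \<notin> R \<eta>))))) True)))"


section \<open>The TrollThrottle protocol\<close>

type_synonym params = "nat \<times> data" \<comment> \<open>security parameter, reference string\<close>
type_synonym issuer_key = "data \<times> data" \<comment> \<open>the issuer key pair\<close>

definition tt_setup :: "nizk \<Rightarrow> nat \<Rightarrow> params pmf" where
  "tt_setup Z \<eta> = bind_pmf (zk_setup Z \<eta>) (\<lambda>\<rho>J. return_pmf (\<eta>, \<rho>J))"

definition tt_keygen :: "daa \<Rightarrow> params \<Rightarrow> (data \<times> issuer_key) pmf" where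
  "tt_keygen D = (\<lambda>(\<eta>, \<rho>J). bind_pmf (daa_setup D \<eta>) (\<lambda>(pk, sk). return_pmf (pk, (pk, sk))))"

definition tt_join :: "daa \<Rightarrow> nizk \<Rightarrow> params \<Rightarrow> data \<Rightarrow> data \<Rightarrow> (data \<times> data) pmf"
  \<comment> \<open>the message sent by the user; the answer is the user's credential\<close> where
  "tt_join D Z = (\<lambda>(\<eta>, \<rho>J) pkI skU.
     bind_pmf (daa_join_coins D \<eta> pkI) (\<lambda>r.
     let com = daa_join D \<eta> pkI skU r in
     bind_pmf (zk_prove Z \<eta> \<rho>J (com, pkI) (skU, r)) (\<lambda>\<pi>.
     return_pmf (com, \<pi>))))"

definition tt_issue :: "daa \<Rightarrow> nizk \<Rightarrow> params \<Rightarrow> issuer_key \<Rightarrow> data \<times> data \<Rightarrow> data option pmf"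
  \<comment> \<open>\<open>None\<close> if the issuer aborts\<close> where
  "tt_issue D Z = (\<lambda>(\<eta>, \<rho>J) (pkI, skI) (com, \<pi>).
     if zk_verify Z \<eta> \<rho>J (com, pkI) \<pi>
     then bind_pmf (daa_issue D \<eta> skI com) (\<lambda>cred. return_pmf (Some cred))
     else return_pmf None)"

definition tt_join_issue :: "daa \<Rightarrow> nizk \<Rightarrow> params \<Rightarrow> data \<Rightarrow> issuer_key \<Rightarrow> (data \<times> data) option pmf"
  \<comment> \<open>a complete run of the protocol between an honest user and the issuer\<close> where
  "tt_join_issue D Z = (\<lambda>\<rho> pkI skI.
     bind_pmf (daa_user_key D (fst \<rho>) pkI) (\<lambda>skU.
     bind_pmf (tt_join D Z \<rho> pkI skU) (\<lambda>msg.
     bind_pmf (tt_issue D Z \<rho> skI msg) (\<lambda>c.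
     return_pmf (map_option (\<lambda>cred. (skU, cred)) c)))))"

definition tt_comment :: "daa \<Rightarrow> (nat \<Rightarrow> data \<Rightarrow> data) \<Rightarrow> params \<Rightarrow>
    data \<Rightarrow> data \<Rightarrow> data \<Rightarrow> data \<Rightarrow> data \<Rightarrow> (data \<times> data) pmf" where
  "tt_comment D h = (\<lambda>(\<eta>, \<rho>J) pkI skU credU bsn m.
     bind_pmf (daa_sign D \<eta> skU credU bsn (h \<eta> m)) (\<lambda>\<sigma>.
     let nym = nym_gen D \<eta> skU bsn in
     return_pmf (nym, enc (\<sigma>, nym, bsn, h \<eta> m))))"

definition tt_verify :: "daa \<Rightarrow> (nat \<Rightarrow> data \<Rightarrow> data) \<Rightarrow> params \<Rightarrow>
    data \<Rightarrow> data \<Rightarrow> data \<Rightarrow> data \<Rightarrow> data \<Rightarrow> bool" where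
  "tt_verify D h = (\<lambda>(\<eta>, \<rho>J) pkI nym bsn m \<gamma>.
     \<exists>\<sigma> hs :: data. \<gamma> = enc (\<sigma>, nym, bsn, hs) \<and>
       daa_verify D \<eta> pkI hs bsn \<sigma> [] \<and> h \<eta> m = hs \<and>
       nym_extract D \<eta> \<sigma> = nym \<and> verify_bsn D \<eta> \<sigma> bsn)"

definition tt_claim :: "data \<Rightarrow> data \<Rightarrow> data \<Rightarrow> data \<Rightarrow> data \<Rightarrow> data \<Rightarrow> data" where
  "tt_claim pkI skU credU bsn m \<gamma> = \<gamma>"

definition tt_verify_claim :: "daa \<Rightarrow> (nat \<Rightarrow> data \<Rightarrow> data) \<Rightarrow> params \<Rightarrow>
    data \<Rightarrow> data \<Rightarrow> data \<Rightarrow> data \<Rightarrow> data \<Rightarrow> bool" where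
  "tt_verify_claim D h \<rho> pkI bsn m \<gamma> evidence \<longleftrightarrow>
     (\<exists>(\<sigma> :: data) nym (hs :: data). \<gamma> = enc (\<sigma>, nym, bsn, hs) \<and> tt_verify D h \<rho> pkI nym bsn m \<gamma>)"


section \<open>The accountability experiment\<close>

text \<open>
  \<open>USK\<close> maps a user to the signer key, the credential and the verifier. It is a partial function
  since an honest user is created at most once. \<open>REG\<close> contains the users that have registered
  through \<open>JoinSystem\<close>.
\<close>

record state =
  CU :: "data set"
  HU :: "data set"
  VM :: "(data \<times> data) set"
  USK :: "data \<Rightarrow> (data \<times> data \<times> data) option"
  COMM :: "(data \<times> data \<times> data \<times> data \<times> data) set"
  ver :: "data \<Rightarrow> data \<Rightarrow> bool"
  REG :: "data set"

definition init_state :: state where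
  "init_state = \<lparr>CU = {}, HU = {}, VM = {}, USK = (\<lambda>_. None), COMM = {}, ver = (\<lambda>_ _. False), REG = {}\<rparr>"

definition set_ver :: "data \<Rightarrow> data \<Rightarrow> state \<Rightarrow> state" where
  "set_ver V U s = s\<lparr>ver := (ver s)(V := (ver s V)(U := True))\<rparr>"

definition corrupt_user :: "data \<Rightarrow> state \<Rightarrow> (data \<times> data) option \<times> state" where
  "corrupt_user U s =
     (map_option (\<lambda>(skU, credU, V). (skU, credU)) (USK s U),
      s\<lparr>CU := insert U (CU s), HU := HU s - {U}\<rparr>)"

definition corrupt_ver :: "data \<Rightarrow> data \<Rightarrow> state \<Rightarrow> state" where
  "corrupt_ver U V s = (set_ver V U s)\<lparr>VM := insert (V, U) (VM s)\<rparr>"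

definition create_honest_user :: "daa \<Rightarrow> nizk \<Rightarrow> params \<Rightarrow> data \<Rightarrow> issuer_key \<Rightarrow>
    data \<Rightarrow> data \<Rightarrow> state \<Rightarrow> (unit option \<times> state) pmf" where
  "create_honest_user D Z \<rho> pkI skI U V s =
     (if U \<in> HU s \<union> CU s then return_pmf (None, s)
      else let s' = set_ver V U s in
        bind_pmf (tt_join_issue D Z \<rho> pkI skI) (\<lambda>res. return_pmf (case res of
            None \<Rightarrow> (None, s')
          | Some (skU, credU) \<Rightarrow>
              (Some (), s'\<lparr>USK := (USK s')(U \<mapsto> (skU, credU, V)), HU := insert U (HU s')\<rparr>))))"

text \<open>The adversary's only message in the issuing protocol is passed along with the query.\<close>

definition join_system :: "daa \<Rightarrow> nizk \<Rightarrow> params \<Rightarrow> issuer_key \<Rightarrow>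
    data \<Rightarrow> data \<Rightarrow> data \<times> data \<Rightarrow> state \<Rightarrow> (data option \<times> state) pmf" where
  "join_system D Z \<rho> skI U V msg s =
     (if U \<notin> HU s \<union> CU s \<and> ver s V U \<and> U \<notin> REG s
      then bind_pmf (tt_issue D Z \<rho> skI msg) (\<lambda>res. return_pmf (case res of
            None \<Rightarrow> (None, s)
          | Some cred \<Rightarrow> (Some cred, s\<lparr>REG := insert U (REG s)\<rparr>)))
      else return_pmf (None, s))"

definition create_comment :: "daa \<Rightarrow> (nat \<Rightarrow> data \<Rightarrow> data) \<Rightarrow> params \<Rightarrow> data \<Rightarrow>
    data \<Rightarrow> data \<Rightarrow> data \<Rightarrow> state \<Rightarrow> ((data \<times> data) option \<times> state) pmf" where
  "create_comment D h \<rho> pkI U bsn m s =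
     (if U \<in> HU s then
        (case USK s U of
           None \<Rightarrow> return_pmf (None, s)
         | Some (skU, credU, V) \<Rightarrow>
             bind_pmf (tt_comment D h \<rho> pkI skU credU bsn m) (\<lambda>(nym, \<gamma>).
             return_pmf (Some (\<gamma>, nym), s\<lparr>COMM := insert (U, nym, bsn, m, \<gamma>) (COMM s)\<rparr>)))
      else return_pmf (None, s))"

datatype query_name = CorruptUser | CorruptVer | CreateHonestUser | JoinSystem | CreateComment

text \<open>Answers are encoded, with \<open>None\<close> for bottom. Ill-formed queries are answered by \<open>Leaf\<close>.\<close>

definition answer :: "daa \<Rightarrow> nizk \<Rightarrow> (nat \<Rightarrow> data \<Rightarrow> data) \<Rightarrow> params \<Rightarrow> data \<Rightarrow> issuer_key \<Rightarrow>
    query_name \<Rightarrow> data \<Rightarrow> state \<Rightarrow> (data \<times> state) pmf" where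
  "answer D Z h \<rho> pkI skI i q s =
     (case (i, q) of
        (CorruptUser, U) \<Rightarrow> return_pmf (map_prod enc id (corrupt_user U s))
      | (CorruptVer, Node U V) \<Rightarrow> return_pmf (Leaf, corrupt_ver U V s)
      | (CreateHonestUser, Node U V) \<Rightarrow>
          map_pmf (map_prod enc id) (create_honest_user D Z \<rho> pkI skI U V s)
      | (JoinSystem, Node U (Node V (Node com \<pi>))) \<Rightarrow>
          map_pmf (map_prod enc id) (join_system D Z \<rho> skI U V (com, \<pi>) s)
      | (CreateComment, Node U (Node bsn m)) \<Rightarrow>
          map_pmf (map_prod enc id) (create_comment D h \<rho> pkI U bsn m s)
      | _ \<Rightarrow> return_pmf (Leaf, s))"

definition run_adversary :: "daa \<Rightarrow> nizk \<Rightarrow> (nat \<Rightarrow> data \<Rightarrow> data) \<Rightarrow> query_name prog \<Rightarrow>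
    params \<Rightarrow> data \<Rightarrow> issuer_key \<Rightarrow> (data \<times> state \<times> nat) spmf" where
  "run_adversary D Z h A \<rho> pkI skI = run (answer D Z h \<rho> pkI skI) A (enc (\<rho>, pkI)) init_state"

text \<open>
  The adversary's running time, which includes reading the answers to its queries but not their
  computation, is bounded by a polynomial in the security parameter in every possible execution
  of the experiment. No bound is required for answers that cannot occur there.
\<close>

definition ppt_adversary :: "daa \<Rightarrow> nizk \<Rightarrow> (nat \<Rightarrow> data \<Rightarrow> data) \<Rightarrow> query_name prog \<Rightarrow> bool" where
  "ppt_adversary D Z h A \<longleftrightarrow> (\<exists>p :: nat poly. \<forall>\<eta>.
     \<forall>\<rho> \<in> set_pmf (tt_setup Z \<eta>). \<forall>(pkI, skI) \<in> set_pmf (tt_keygen D \<rho>).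
       lossless_spmf (run_adversary D Z h A \<rho> pkI skI) \<and>
       (\<forall>(out, s, t) \<in> set_spmf (run_adversary D Z h A \<rho> pkI skI). t \<le> poly p \<eta>))"

definition accsound_win :: "daa \<Rightarrow> (nat \<Rightarrow> data \<Rightarrow> data) \<Rightarrow> params \<Rightarrow> data \<Rightarrow> state \<Rightarrow> data \<Rightarrow> bool" where
  "accsound_win D h \<rho> pkI s out \<longleftrightarrow>
     (\<exists>bsn m \<gamma> evidence. out = enc (bsn, m, \<gamma>, evidence) \<and>
        (\<nexists>U nym \<gamma>'. (U, nym, bsn, m, \<gamma>') \<in> COMM s) \<and>
        (\<exists>U nym bsn' m'. (U, nym, bsn', m', \<gamma>) \<in> COMM s) \<and>
        tt_verify_claim D h \<rho> pkI bsn m \<gamma> evidence)"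

definition accsound_exp :: "daa \<Rightarrow> nizk \<Rightarrow> (nat \<Rightarrow> data \<Rightarrow> data) \<Rightarrow> query_name prog \<Rightarrow> nat \<Rightarrow> bool spmf" where
  "accsound_exp D Z h A \<eta> =
     bind_spmf (spmf_of_pmf (tt_setup Z \<eta>)) (\<lambda>\<rho>.
     bind_spmf (spmf_of_pmf (tt_keygen D \<rho>)) (\<lambda>(pkI, skI).
     bind_spmf (run_adversary D Z h A \<rho> pkI skI) (\<lambda>(out, s, t).
     return_spmf (accsound_win D h \<rho> pkI s out))))"

end

theory Submission
  imports Defs
begin

text \<open>
  A winning adversary outputs a comment \<open>\<gamma>\<close> that was created by the oracle for a basename and a
  message \<open>m'\<close>, and claims it for a pair \<open>(dom, m)\<close> that was never used with the oracle. Since \<open>\<gamma>\<close>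
  contains its basename and the hash of its message, the basenames agree and \<open>h m = h m'\<close>, so
  \<open>m \<noteq> m'\<close> is a collision of \<open>h\<close>.

  The collision finder plays the experiment by itself. This requires an actual program, obtained by
  compiling the adversary into a program without external procedures whose data carry the state of
  the experiment as an association list. The compiled program is compared with the adversary by a
  one-sided simulation, which passes to the limit in the semantics of loops; since the adversary is
  lossless in the experiment, the simulation then accounts for every outcome of the compiled
  program and bounds its running time.
\<close>

section \<open>Simulations between subdistributions\<close>

text \<open>Two obstacles shape the reduction. Collision resistance speaks about worst-case
  polynomial time, whereas the adversary is bounded only in executions of the experiment; for other
  reference strings, keys or answers it may run forever. Hence polynomial time is stated relative to
  a set of inputs. Moreover, the adversary is not charged for the computation of answers, whose cost
  depends on the size of the simulated state, which in turn grows with the queries. The circle is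
  broken by a conditional bound: each time unit of the adversary lets the state grow by at most
  \<open>c\<close> and, as long as the data stay below a size \<open>m\<close>, costs the compiled
  program at most \<open>G\<close>. Only afterwards is \<open>m\<close> chosen from the adversary's
  own time bound, so that the condition never fails. The reduction is tight: winning is mapped to a
  collision without loss in probability.\<close>

text \<open>
  \<open>sim R p q\<close> is implied by a coupling of \<open>p\<close> with a part of \<open>q\<close>. Unlike the existence of a coupling, it is
  evidently preserved by suprema in \<open>p\<close>, without a max-flow min-cut argument; the test functions \<open>F\<close>
  and \<open>G\<close> play the role of functions into the unit interval.
\<close>

definition sim :: "('a \<Rightarrow> 'b \<Rightarrow> bool) \<Rightarrow> 'a spmf \<Rightarrow> 'b spmf \<Rightarrow> bool" where
  "sim R p q \<longleftrightarrow> (\<forall>(F :: 'a \<Rightarrow> unit spmf) G. (\<forall>a b. R a b \<longrightarrow> ord_spmf (=) (F a) (G b)) \<longrightarrow>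
     ord_spmf (=) (bind_spmf p F) (bind_spmf q G))"

lemma sim_return: "R a b \<Longrightarrow> sim R (return_spmf a) (return_spmf b)"
  by (simp add: sim_def)

text \<open>A test function preceded by \<open>f\<close> or \<open>g\<close> is again a test
  function, so that no couplings have to be chosen.\<close>

lemma sim_bind:
  assumes "sim R p q" "\<And>a b. R a b \<Longrightarrow> sim S (f a) (g b)"
  shows "sim S (bind_spmf p f) (bind_spmf q g)"
  using assms by (simp add: sim_def)

lemma sim_mono: "sim R p q \<Longrightarrow> (\<And>a b. R a b \<Longrightarrow> S a b) \<Longrightarrow> sim S p q"
  by (simp add: sim_def)

text \<open>Letting the test function vanish outside the support of \<open>p\<close> does not change
  \<open>bind_spmf p F\<close>, and makes the comparison trivial there. This is how facts about all
  outcomes of a run, such as \<open>run_size\<close>, enter the relation.\<close>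

lemma sim_restrict:
  assumes "sim R p q" "\<And>a b. R a b \<Longrightarrow> a \<in> set_spmf p \<Longrightarrow> S a b"
  shows "sim S p q"
  unfolding sim_def
proof (intro allI impI)
  fix F :: "'a \<Rightarrow> unit spmf" and G
  assume FG: "\<forall>a b. S a b \<longrightarrow> ord_spmf (=) (F a) (G b)"
  let ?F = "\<lambda>a. if a \<in> set_spmf p then F a else return_pmf None"
  have "ord_spmf (=) (bind_spmf p ?F) (bind_spmf q G)"
    using assms FG by (auto simp: sim_def)
  then show "ord_spmf (=) (bind_spmf p F) (bind_spmf q G)"
    by (simp cong: bind_spmf_cong_simp)
qed

lemma rel_spmf_imp_sim:
  assumes "rel_spmf R p q"
  shows "sim R p q"
proof -
  from assms obtain pq where pq: "\<And>a b. (a, b) \<in> set_spmf pq \<Longrightarrow> R a b"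
    and "p = map_spmf fst pq" "q = map_spmf snd pq"
    by (auto elim: rel_spmfE)
  then show ?thesis
    by (auto simp: sim_def bind_map_spmf intro!: ord_spmf_bind_reflI)
qed

text \<open>For fixed test functions the left side is continuous in \<open>w\<close> and the right
  side is constant, so the property survives suprema. Only the left loop is approximated; the index
  \<open>z\<close>, tied by \<open>P\<close> to the arguments of the loop, lets the right side
  change from one iteration to the next.\<close>

lemma while_loop_sim_induct:
  assumes step: "\<And>w. (\<And>z x s t. P z x s t \<Longrightarrow> sim (R z) (w x s t) (q z))
      \<Longrightarrow> (\<And>z x s t. P z x s t \<Longrightarrow> sim (R z) (bind_spmf (test x s) (\<lambda>(b, s1, t1).
       if b = Leaf then return_spmf (x, s1, t + cost x + t1)
       else bind_spmf (body x s1) (\<lambda>(y, s2, t2). w y s2 (t + cost x + t1 + t2)))) (q z))"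
  shows "P z x s t \<Longrightarrow> sim (R z) (while_loop test body x s t) (q z)"
proof -
  have "\<forall>z x s t. P z x s t \<longrightarrow> sim (R z) (while_loop test body x s t) (q z)"
  proof (rule while_loop.fixp_induct[where P="\<lambda>w. \<forall>z x s t. P z x s t \<longrightarrow> sim (R z) (w test body x s t) (q z)"])
    show "ccpo.admissible (fun_lub lub_spmf) (fun_ord (ord_spmf (=)))
     (\<lambda>f. \<forall>z x s t. P z x s t \<longrightarrow> sim (R z) (curry (curry (curry (curry f))) test body x s t) (q z))"
     unfolding sim_def curry_def
     by (intro admissible_all admissible_imp admissible_leI[OF ccpo_spmf]) (simp_all add: cont_intro)
  qed (use step in \<open>auto simp: sim_def\<close>)
  then show "P z x s t \<Longrightarrow> sim (R z) (while_loop test body x s t) (q z)" by blast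
qed

lemma sim_measure:
  assumes "sim R p q" and "\<And>a b. R a b \<Longrightarrow> a \<in> A \<Longrightarrow> b \<in> B"
  shows "measure (measure_spmf p) A \<le> measure (measure_spmf q) B"
proof -
  let ?F = "\<lambda>a. if a \<in> A then return_spmf () else return_pmf None"
  let ?G = "\<lambda>a. if a \<in> B then return_spmf () else return_pmf None"
  have *: "spmf (bind_spmf r (\<lambda>a. if a \<in> C then return_spmf () else return_pmf None)) ()
     = measure (measure_spmf r) C" for r and C :: "'c set"
  proof -
    have "(\<lambda>x. spmf (if x \<in> C then return_spmf () else return_pmf None) ()) = indicat_real C"
      by (auto simp: fun_eq_iff)
    then show ?thesis by (simp add: spmf_bind)
  qed
  have "ord_spmf (=) (bind_spmf p ?F) (bind_spmf q ?G)"
    using assms by (auto simp: sim_def)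
  from ord_spmf_eq_leD[OF this, of "()"] show ?thesis by (simp only: *)
qed

text \<open>If \<open>p\<close> has full mass, then \<open>q\<close> puts full mass on the elements
  related to some outcome, and nothing is left for others. Thus a one-sided comparison controls
  every outcome of \<open>q\<close>.\<close>

lemma sim_lossless:
  assumes "sim R p q" "lossless_spmf p"
  shows "lossless_spmf q" "\<And>b. b \<in> set_spmf q \<Longrightarrow> \<exists>a. R a b"
proof -
  let ?B = "{b. \<exists>a. R a b}"
  have "measure (measure_spmf p) UNIV \<le> measure (measure_spmf q) ?B"
    by (rule sim_measure[OF assms(1)]) auto
  then have 1: "1 \<le> measure (measure_spmf q) ?B"
    using assms(2) by (simp add: lossless_spmf_def weight_spmf_def)
  also have le: "measure (measure_spmf q) ?B \<le> weight_spmf q"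
    unfolding weight_spmf_def by (intro measure_spmf.finite_measure_mono) auto
  finally show ll: "lossless_spmf q"
    by (simp add: lossless_spmf_def weight_spmf_le_1 antisym)
  fix b assume b: "b \<in> set_spmf q"
  show "\<exists>a. R a b"
  proof (rule ccontr)
    assume "\<nexists>a. R a b"
    then have "measure (measure_spmf q) ?B \<le> measure (measure_spmf q) (UNIV - {b})"
      by (intro measure_spmf.finite_measure_mono) auto
    also have "\<dots> = weight_spmf q - measure (measure_spmf q) {b}"
      unfolding weight_spmf_def by (subst measure_spmf.finite_measure_Diff) auto
    also have "measure (measure_spmf q) {b} = spmf q b"
      by (simp add: spmf_conv_measure_spmf)
    finally have "spmf q b \<le> 0" using 1 ll unfolding lossless_spmf_def by linarith
    then have "spmf q b = 0" using pmf_nonneg[of q "Some b"] by linarith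
    then show False using b by (simp add: in_set_spmf_iff_spmf)
  qed
qed

section \<open>Threading the state of the external procedures through a program\<close>

text \<open>Fixed-point induction applied to supports: the support of a supremum is the union of the
  supports.\<close>

lemma while_loop_support_induct [consumes 1, case_names step]:
  assumes "a \<in> set_spmf (while_loop test body x s t)"
    and step: "\<And>w x s t a. (\<And>x s t a. a \<in> set_spmf (w x s t) \<Longrightarrow> Q x s t a) \<Longrightarrow>
      a \<in> set_spmf (bind_spmf (test x s) (\<lambda>(b, s1, t1).
       if b = Leaf then return_spmf (x, s1, t + cost x + t1)
       else bind_spmf (body x s1) (\<lambda>(y, s2, t2). w y s2 (t + cost x + t1 + t2)))) \<Longrightarrow> Q x s t a"
  shows "Q x s t a"
proof -
  have "\<forall>x s t. set_spmf (while_loop test body x s t) \<subseteq> {a. Q x s t a}"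
  proof (rule while_loop.fixp_induct[where P="\<lambda>w. \<forall>x s t. set_spmf (w test body x s t) \<subseteq> {a. Q x s t a}"])
    show "ccpo.admissible (fun_lub lub_spmf) (fun_ord (ord_spmf (=)))
     (\<lambda>f. \<forall>x s t. set_spmf (curry (curry (curry (curry f))) test body x s t) \<subseteq> {a. Q x s t a})"
     unfolding curry_def by (intro admissible_all) (simp add: cont_intro)
  next
    fix w :: "(data \<Rightarrow> 'a \<Rightarrow> (data \<times> 'a \<times> nat) spmf) \<Rightarrow> (data \<Rightarrow> 'a \<Rightarrow> (data \<times> 'a \<times> nat) spmf)
      \<Rightarrow> data \<Rightarrow> 'a \<Rightarrow> nat \<Rightarrow> (data \<times> 'a \<times> nat) spmf"
    assume IH: "\<forall>x s t. set_spmf (w test body x s t) \<subseteq> {a. Q x s t a}"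
    then show "\<forall>x s t. set_spmf (bind_spmf (test x s) (\<lambda>(b, s1, t1).
       if b = Leaf then return_spmf (x, s1, t + cost x + t1)
       else bind_spmf (body x s1) (\<lambda>(y, s2, t2). w test body y s2 (t + cost x + t1 + t2)))) \<subseteq> {a. Q x s t a}"
      using step[of "w test body"] by blast
  qed simp
  then show ?thesis using assms(1) by blast
qed

lemma while_loop_size:
  assumes body: "\<And>x s y s' t. (y, s', t) \<in> set_spmf (body x s) \<Longrightarrow> size y \<le> t"
    and in_loop: "r \<in> set_spmf (while_loop test body x s t)"
  shows "t + size x < snd (snd r) \<and> size (fst r) \<le> snd (snd r)"
  using in_loop
proof (induction rule: while_loop_support_induct)
  case (step w x s t a)
  from step(2) obtain b s1 t1 where 1: "a \<in> set_spmf (if b = Leaf then return_spmf (x, s1, t + cost x + t1)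
       else bind_spmf (body x s1) (\<lambda>(y, s2, t2). w y s2 (t + cost x + t1 + t2)))"
    by (auto simp: set_bind_spmf)
  show ?case
  proof (cases "b = Leaf")
    case True
    then show ?thesis using 1 by simp
  next
    case False
    then obtain y s2 t2 where 2: "(y, s2, t2) \<in> set_spmf (body x s1)"
      and 3: "a \<in> set_spmf (w y s2 (t + cost x + t1 + t2))"
      using 1 by (auto simp: set_bind_spmf)
    from step(1)[OF 3] body[OF 2] show ?thesis by linarith
  qed
qed

text \<open>Every construct is charged for the data that it reads and creates, so time bounds all
  intermediate trees. The overhead of the compiled program, which copies such trees, is thereby
  measured in the time of the original one.\<close>

lemma run_size:
  "(y, s', t) \<in> set_spmf (run H P x s) \<Longrightarrow> size x < t \<and> size y \<le> t"
proof (induction P arbitrary: x s y s' t)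
  case (While c p)
  have "0 + size x < snd (snd (y, s', t)) \<and> size (fst (y, s', t)) \<le> snd (snd (y, s', t))"
    using While by (intro while_loop_size[of "run H p" _ "run H c" x s]) auto
  then show ?case by simp
next
  case (Pair P Q)
  from Pair.prems obtain y1 s1 t1 z1 s2 t2 where "(y1, s1, t1) \<in> set_spmf (run H P x s)"
    "(z1, s2, t2) \<in> set_spmf (run H Q x s1)" "y = Node y1 z1" "t = cost x + t1 + t2"
    by (auto simp: set_bind_spmf)
  with Pair.IH(1)[OF this(1)] Pair.IH(2)[OF this(2)] show ?case by simp
next
  case (Comp P Q)
  from Comp.prems obtain y1 s1 t1 z1 s2 t2 where "(y1, s1, t1) \<in> set_spmf (run H Q x s)"
    "(z1, s2, t2) \<in> set_spmf (run H P y1 s1)" "y = z1" "t = cost x + t1 + t2"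
    by (auto simp: set_bind_spmf)
  with Comp.IH(1)[OF this(2)] show ?case by simp
next
  case (Cond C P Q)
  from Cond.prems obtain b s1 t1 t2 where "(b, s1, t1) \<in> set_spmf (run H C x s)"
    and 1: "(y, s', t2) \<in> set_spmf (if b = Leaf then run H Q x s1 else run H P x s1)" "t = cost x + t1 + t2"
    by (auto simp: set_bind_spmf)
  then have "size y \<le> t2" using Cond.IH(2,3)[of y s' t2 x s1] by (simp split: if_splits)
  with 1 show ?case by simp
next
  case Fst
  then show ?case by (cases x) auto
next
  case Snd
  then show ?case by (cases x) auto
qed (auto simp: enc_bool_def)

section \<open>Semantics of programs without external procedures\<close>

definition exec :: "unit prog \<Rightarrow> data \<Rightarrow> (data \<times> nat) spmf" where
  "exec P x = map_spmf (\<lambda>(y, _, t). (y, t)) (run (\<lambda>_ _ s. return_pmf (Leaf, s)) P x ())"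

definition exec_loop :: "unit prog \<Rightarrow> unit prog \<Rightarrow> data \<Rightarrow> nat \<Rightarrow> (data \<times> nat) spmf" where
  "exec_loop C P x t = map_spmf (\<lambda>(y, _, t). (y, t))
     (while_loop (run (\<lambda>_ _ s. return_pmf (Leaf, s)) C) (run (\<lambda>_ _ s. return_pmf (Leaf, s)) P) x () t)"

lemma exec_simps [simp]:
  "exec Ident x = return_spmf (x, cost x)"
  "exec (Const d) x = return_spmf (d, cost x + size d)"
  "exec Fst x = return_spmf (left x, cost x)"
  "exec Snd x = return_spmf (right x, cost x)"
  "exec Eq x = return_spmf (enc (left x = right x), cost x + 1)"
  "exec Flip x = map_spmf (\<lambda>b. (enc b, cost x + 1)) coin_spmf"
  "exec (Pair p q) x = bind_spmf (exec p x) (\<lambda>(y, t1). bind_spmf (exec q x) (\<lambda>(z, t2).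
     return_spmf (Node y z, cost x + t1 + t2)))"
  "exec (Comp p q) x = bind_spmf (exec q x) (\<lambda>(y, t1). bind_spmf (exec p y) (\<lambda>(z, t2).
     return_spmf (z, cost x + t1 + t2)))"
  "exec (Cond c p q) x = bind_spmf (exec c x) (\<lambda>(b, t1).
     bind_spmf (if b = Leaf then exec q x else exec p x) (\<lambda>(y, t2). return_spmf (y, cost x + t1 + t2)))"
  "exec (While c p) x = exec_loop c p x 0"
  by (auto simp: exec_def exec_loop_def map_spmf_bind_spmf bind_map_spmf o_def case_prod_unfold
      spmf.map_comp if_distrib intro!: bind_spmf_cong)

lemma exec_loop_unfold:
  "exec_loop c p x t = bind_spmf (exec c x) (\<lambda>(b, t1).
     if b = Leaf then return_spmf (x, t + cost x + t1)
     else bind_spmf (exec p x) (\<lambda>(y, t2). exec_loop c p y (t + cost x + t1 + t2)))"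
  unfolding exec_loop_def exec_def
  by (subst while_loop.simps)
    (auto simp: map_spmf_bind_spmf bind_map_spmf o_def case_prod_unfold intro!: bind_spmf_cong)

lemma exec_size: "(y, t) \<in> set_spmf (exec P x) \<Longrightarrow> size x < t \<and> size y \<le> t"
  by (auto simp: exec_def dest: run_size)

text \<open>
  A compiled program maps \<open>Node x st\<close> to \<open>Node y st'\<close>, where \<open>st\<close> and \<open>st'\<close> represent the state of
  the external procedures. While another part of a program runs, the input \<open>x\<close> is saved in
  \<open>Node (Node y st) x\<close>, from which \<open>resume\<close> recovers \<open>Node x st\<close>. A loop runs on such trees, as its
  test may change the state.
\<close>

abbreviation resume :: "unit prog" where
  "resume \<equiv> Pair Snd (Comp Snd Fst)"

primrec compile :: "('o \<Rightarrow> unit prog) \<Rightarrow> 'o prog \<Rightarrow> unit prog" where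
  "compile Or Ident = Ident"
| "compile Or (Const d) = Pair (Const d) Snd"
| "compile Or Fst = Pair (Comp Fst Fst) Snd"
| "compile Or Snd = Pair (Comp Snd Fst) Snd"
| "compile Or Eq = Pair (Comp Eq Fst) Snd"
| "compile Or Flip = Pair Flip Snd"
| "compile Or (Call i) = Or i"
| "compile Or (Pair p q) = Comp (Pair (Pair Fst (Comp Fst Snd)) (Comp Snd Snd))
     (Comp (Pair (Comp Fst Fst) (Comp (compile Or q) resume)) (Pair (compile Or p) Fst))"
| "compile Or (Comp p q) = Comp (compile Or p) (compile Or q)"
| "compile Or (Cond c p q) =
     Comp (Cond (Comp Fst Fst) (Comp (compile Or p) resume) (Comp (compile Or q) resume)) (Pair (compile Or c) Fst)"
| "compile Or (While c p) = Comp resume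
     (Comp (While (Comp Fst Fst) (Comp (Pair (compile Or c) Fst) (Comp (compile Or p) resume))) (Pair (compile Or c) Fst))"

text \<open>
  \<open>c\<close> bounds the growth of the state per time unit, and \<open>G\<close> the slowdown as long as all data have size
  at most \<open>m\<close>. The factor \<open>1000\<close> generously covers the cost of the plumbing in \<open>compile\<close>.
\<close>

locale simulation =
  fixes H :: "'o \<Rightarrow> data \<Rightarrow> 's \<Rightarrow> (data \<times> 's) pmf" and Or :: "'o \<Rightarrow> unit prog"
    and I :: "'s \<Rightarrow> data \<Rightarrow> bool" and c m G :: nat
  assumes c: "1 \<le> c" and G: "1000 * (m + 1) \<le> G"
    and query: "I s st \<Longrightarrow> sim (\<lambda>(y, s') (z, t'). \<exists>st'. z = Node y st' \<and> I s' st' \<and>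
      size st' \<le> size st + c * (cost x + size y) \<and> (m < size x + size st \<or> t' \<le> G))
      (spmf_of_pmf (H i x s)) (exec (Or i) (Node x st))"
begin

text \<open>The time bound may fail only if the size that the state could have reached exceeds
  \<open>m\<close>. This potential size replaces the actual one because it grows with
  \<open>t\<close>: a limit once exceeded stays exceeded in longer runs.\<close>

abbreviation rel where
  "rel st \<equiv> \<lambda>(y, s', t) (z, t'). \<exists>st'. z = Node y st' \<and> I s' st' \<and>
      size st' \<le> size st + c * t \<and> (m < size st + c * t \<or> t' \<le> t * G)"

lemma le_c: "t \<le> c * t"
  using c by simp

lemma relI:
  "I s' st' \<Longrightarrow> z = Node y st' \<Longrightarrow> size st' \<le> size st + c * t \<and> (m < size st + c * t \<or> t' \<le> t * G) \<Longrightarrow>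
    rel st (y, s', t) (z, t')"
  by auto

text \<open>The arithmetic shared by all constructs: two pieces run one after the other, with times
  \<open>t1\<close>, \<open>t2\<close> in the original and \<open>t1'\<close>, \<open>t2'\<close> in
  the compiled program. Below the limit all sizes involved are at most \<open>m\<close>, and the
  unit in \<open>Suc\<close> pays, through the factor \<open>G\<close>, for an overhead of
  \<open>1000 * (m + 1)\<close>.\<close>

lemma budget:
  fixes st st1 st2 x t1 t2 t1' t2' tot :: nat
  assumes "m < st + c * t1 \<or> t1' \<le> t1 * G" "m < st1 + c * t2 \<or> t2' \<le> t2 * G"
    and "st1 \<le> st + c * t1" "st2 \<le> st1 + c * t2"
    and tot: "st \<le> m \<Longrightarrow> x \<le> m \<Longrightarrow> t1 \<le> m \<Longrightarrow> t2 \<le> m \<Longrightarrow> st1 \<le> m \<Longrightarrow> st2 \<le> m \<Longrightarrow>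
      tot \<le> 1000 * (m + 1) + t1' + t2'"
  shows "st2 \<le> st + c * Suc (x + t1 + t2) \<and>
    (m < st + c * Suc (x + t1 + t2) \<or> tot \<le> Suc (x + t1 + t2) * G)"
proof (cases "m < st + c * Suc (x + t1 + t2)")
  case True
  then show ?thesis using assms(3,4) by (simp add: distrib_left)
next
  case False
  then have le: "st + c * t1 + c * t2 + c * x \<le> m" by (simp add: distrib_left)
  then have "t1' + t2' \<le> t1 * G + t2 * G"
    using assms(1-3) by (intro add_mono) linarith+
  moreover have "tot \<le> 1000 * (m + 1) + t1' + t2'"
    by (rule tot) (use le le_c[of x] le_c[of t1] le_c[of t2] assms(3,4) in linarith)+
  ultimately have "tot \<le> G + t1 * G + t2 * G" using G by linarith
  then show ?thesis using assms(3,4) by (simp add: distrib_left distrib_right)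
qed

lemma sim_run_bind:
  assumes "I s st" "\<And>s st. I s st \<Longrightarrow> sim (rel st) (run H P x s) (exec Q (Node x st))"
    and "\<And>y s' t st' t'. size x < t \<Longrightarrow> size y \<le> t \<Longrightarrow> I s' st' \<Longrightarrow> size st' \<le> size st + c * t \<Longrightarrow>
      m < size st + c * t \<or> t' \<le> t * G \<Longrightarrow> sim S (f (y, s', t)) (g (Node y st', t'))"
  shows "sim S (bind_spmf (run H P x s) f) (bind_spmf (exec Q (Node x st)) g)"
proof (rule sim_bind)
  show "sim (\<lambda>a b. rel st a b \<and> a \<in> set_spmf (run H P x s)) (run H P x s) (exec Q (Node x st))"
    by (rule sim_restrict[OF assms(2)[OF assms(1)]]) simp
qed (auto intro!: assms(3) dest: run_size)

lemma simulation_return: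
  assumes "I s st" "size st \<le> m \<Longrightarrow> size x \<le> m \<Longrightarrow> d \<le> m \<Longrightarrow> t' \<le> 1000 * (m + 1)"
  shows "sim (rel st) (return_spmf (y, s, Suc (size x + d))) (return_spmf (Node y st, t'))"
proof -
  \<comment> \<open>The summand \<open>0\<close> makes the goal match \<open>budget\<close>: the
    extra charge \<open>d\<close> acts as a first piece without compiled time, and the second piece
    is empty.\<close>
  have "size st \<le> size st + c * Suc (size x + d + 0) \<and>
      (m < size st + c * Suc (size x + d + 0) \<or> t' \<le> Suc (size x + d + 0) * G)"
    by (rule budget[where ?t1'=0 and ?t2'=0 and ?st1.0="size st"]) (use assms(2) in auto)
  then show ?thesis by (intro sim_return relI[OF assms(1) refl]) simp
qed

lemma simulation_Pair:
  assumes P: "\<And>x s st. I s st \<Longrightarrow> sim (rel st) (run H P x s) (exec (compile Or P) (Node x st))"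
    and Q: "\<And>x s st. I s st \<Longrightarrow> sim (rel st) (run H Q x s) (exec (compile Or Q) (Node x st))"
    and I: "I s st"
  shows "sim (rel st) (run H (Pair P Q) x s) (exec (compile Or (Pair P Q)) (Node x st))"
  apply simp
  apply (rule sim_run_bind[OF I P], assumption)
  apply simp
  apply (rule sim_run_bind[OF _ Q], assumption, assumption)
  apply simp
  apply (rule sim_return)
  apply (rule relI, assumption, rule refl)
  apply (rule budget, assumption, assumption, assumption, assumption)
  \<comment> \<open>Premises 2 and 7 bound the intermediate results by their times, and 11 to 16 are
    the bounds by \<open>m\<close> supplied by \<open>budget\<close>.\<close>
  subgoal premises p
    using p(2,7,11-16) by simp
  done

lemma simulation_Comp:
  assumes P: "\<And>x s st. I s st \<Longrightarrow> sim (rel st) (run H P x s) (exec (compile Or P) (Node x st))"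
    and Q: "\<And>x s st. I s st \<Longrightarrow> sim (rel st) (run H Q x s) (exec (compile Or Q) (Node x st))"
    and I: "I s st"
  shows "sim (rel st) (run H (Comp P Q) x s) (exec (compile Or (Comp P Q)) (Node x st))"
  apply simp
  apply (rule sim_run_bind[OF I Q], assumption)
  apply simp
  apply (rule sim_run_bind[OF _ P], assumption, assumption)
  apply simp
  apply (rule sim_return)
  apply (rule relI, assumption, rule refl)
  apply (rule budget, assumption, assumption, assumption, assumption)
  subgoal premises p
    using p(2,7,11-16) by simp
  done

lemma simulation_Cond:
  assumes C: "\<And>x s st. I s st \<Longrightarrow> sim (rel st) (run H C x s) (exec (compile Or C) (Node x st))"
    and P: "\<And>x s st. I s st \<Longrightarrow> sim (rel st) (run H P x s) (exec (compile Or P) (Node x st))"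
    and Q: "\<And>x s st. I s st \<Longrightarrow> sim (rel st) (run H Q x s) (exec (compile Or Q) (Node x st))"
    and I: "I s st"
  shows "sim (rel st) (run H (Cond C P Q) x s) (exec (compile Or (Cond C P Q)) (Node x st))"
  apply simp
  apply (rule sim_run_bind[OF I C], assumption)
  subgoal for b s1 t1 st1 t1'
    apply (cases "b = Leaf")
     apply simp
     apply (rule sim_run_bind[OF _ Q], assumption, assumption)
     apply simp
     apply (rule sim_return)
     apply (rule relI, assumption, rule refl)
     apply (rule budget, assumption, assumption, assumption, assumption)
    subgoal premises p
      using p(2,7,11-16) by simp
    apply simp
    apply (rule sim_run_bind[OF _ P], assumption, assumption)
    apply simp
    apply (rule sim_return)
    apply (rule relI, assumption, rule refl)
    apply (rule budget, assumption, assumption, assumption, assumption)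
    subgoal premises p
      using p(2,7,11-16) by simp
    done
  done

text \<open>The summand \<open>500 * (m + 1)\<close> reserves time for leaving the loop.\<close>

definition loop_rel where
  "loop_rel t0 t0' st = (\<lambda>(y, s', t) (z, t'). \<exists>d st'. t = t0 + d \<and> z = Node (Node Leaf st') y \<and> I s' st' \<and>
      size st' \<le> size st + c * d \<and> (m < size st + c * d \<or> t' + 500 * (m + 1) \<le> t0' + d * G))"

text \<open>Moving \<open>t0'\<close> to the left by truncated subtraction brings the claim into the
  form of the conclusion of \<open>budget\<close>.\<close>

lemma loop_relI:
  "t = t0 + d \<Longrightarrow> I s' st' \<Longrightarrow> z = Node (Node Leaf st') y \<Longrightarrow>
    size st' \<le> size st + c * d \<and> (m < size st + c * d \<or> t' + 500 * (m + 1) - t0' \<le> d * G) \<Longrightarrow>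
    loop_rel t0 t0' st (y, s', t) (z, t')"
  by (auto simp: loop_rel_def)

lemma loop_relE:
  assumes "loop_rel t0 t0' st (y, s', t) (z, t')"
  obtains d st' where "t = t0 + d" "z = Node (Node Leaf st') y" "I s' st'"
    "size st' \<le> size st + c * d" "m < size st + c * d \<or> t' + 500 * (m + 1) \<le> t0' + d * G"
  using assms by (auto simp: loop_rel_def)

text \<open>
  The compiled loop is considered from the evaluation of its test, which takes time \<open>t1\<close>. Depending on
  whether this evaluation belongs to the loop body or precedes the loop, \<open>t1\<close> is counted in the time
  \<open>f t1\<close> at which the loop is entered or in the time \<open>e t1\<close> added afterwards.
\<close>

lemma simulation_while_loop:
  fixes C P :: "'o prog"
  defines "test \<equiv> Comp Fst Fst"
    and "body \<equiv> Comp (Pair (compile Or C) Fst) (Comp (compile Or P) resume)"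
  assumes C: "\<And>x s st. I s st \<Longrightarrow> sim (rel st) (run H C x s) (exec (compile Or C) (Node x st))"
    and P: "\<And>x s st. I s st \<Longrightarrow> sim (rel st) (run H P x s) (exec (compile Or P) (Node x st))"
    and I: "I s st" and f: "\<And>t1. f t1 + e t1 \<le> f 0 + e 0 + t1"
  shows "sim (loop_rel t0 (f 0 + e 0) st)
    (while_loop (run H C) (run H P) x s t0)
    (bind_spmf (exec (compile Or C) (Node x st)) (\<lambda>(w, t1).
      bind_spmf (exec_loop test body (Node w x) (f t1)) (\<lambda>(z, t2). return_spmf (z, t2 + e t1))))"
proof -
  let ?cont = "\<lambda>x f e (w, t1). bind_spmf (exec_loop test body (Node w x) (f t1))
    (\<lambda>(z, t2). return_spmf (z, t2 + e t1))"
  let ?start = "\<lambda>x st f e. bind_spmf (exec (compile Or C) (Node x st)) (?cont x f e)"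
  have "sim ((\<lambda>(x, st, t0, f, e). loop_rel t0 (f 0 + e 0) st) (x, st, t0, f, e))
    (while_loop (run H C) (run H P) x s t0) ((\<lambda>(x, st, t0, f, e). ?start x st f e) (x, st, t0, f, e))"
  \<comment> \<open>The functions \<open>f\<close> and \<open>e\<close> belong to the index, since
    the first test may be timed differently from those inside the loop body.\<close>
  proof (rule while_loop_sim_induct[where P="\<lambda>(x', st, t0', f, e) x s t0. x' = x \<and> t0' = t0 \<and> I s st \<and>
      (\<forall>t1. f t1 + e t1 \<le> f 0 + e 0 + t1)"])
    fix w x s t and z :: "data \<times> data \<times> nat \<times> (nat \<Rightarrow> nat) \<times> (nat \<Rightarrow> nat)"
    assume hyp: "\<And>z x s t. (case z of (x', st, t0', f, e) \<Rightarrow> \<lambda>x s t0. x' = x \<and> t0' = t0 \<and> I s st \<and>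
        (\<forall>t1. f t1 + e t1 \<le> f 0 + e 0 + t1)) x s t \<Longrightarrow>
      sim (case z of (x, st, t0, f, e) \<Rightarrow> loop_rel t0 (f 0 + e 0) st) (w x s t)
        (case z of (x, st, t0, f, e) \<Rightarrow> ?start x st f e)"
    have IH: "sim (loop_rel t (f 0 + e 0) st) (w x s t) (bind_spmf (exec (compile Or C) (Node x st)) g)"
      if "I s st" "\<And>w t1. g (w, t1) = ?cont x f e (w, t1)" "\<And>t1. f t1 + e t1 \<le> f 0 + e 0 + t1"
      for x st s t f e g
    proof -
      have "g = ?cont x f e"
        using that(2) by (simp add: fun_eq_iff)
      moreover have "sim (loop_rel t (f 0 + e 0) st) (w x s t) (?start x st f e)"
        using hyp[of "(x, st, t, f, e)" x s t] that(1,3) by auto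
      ultimately show ?thesis by simp
    qed
    assume "(case z of (x', st, t0', f, e) \<Rightarrow> \<lambda>x s t0. x' = x \<and> t0' = t0 \<and> I s st \<and>
      (\<forall>t1. f t1 + e t1 \<le> f 0 + e 0 + t1)) x s t"
    then obtain st f e where z: "z = (x, st, t, f, e)" and I: "I s st"
      and f: "\<And>t1. f t1 + e t1 \<le> f 0 + e 0 + t1"
      by (auto split: prod.splits)
    have "sim (loop_rel t (f 0 + e 0) st)
        (bind_spmf (run H C x s) (\<lambda>(b, s1, t1).
          if b = Leaf then return_spmf (x, s1, t + cost x + t1)
          else bind_spmf (run H P x s1) (\<lambda>(y, s2, t2). w y s2 (t + cost x + t1 + t2))))
        (?start x st f e)"
      apply (rule sim_run_bind[OF I C], assumption)
      subgoal for b s1 t1 st1 t1'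
        apply (subst exec_loop_unfold)
        apply (cases "b = Leaf")
         apply (simp add: test_def)
         apply (rule sim_return)
         apply (rule loop_relI[where d="Suc (size x + t1 + 0)"], simp, assumption, rule refl)
         apply (rule budget[where ?t2'=0], assumption, simp, assumption, simp)
        subgoal premises p
          using p(6-11) f[of t1'] by simp
        apply (simp add: test_def body_def)
        apply (rule sim_run_bind[OF _ P], assumption, assumption)
        apply simp
        subgoal for y s2 t2 st2 t2'
          apply (rule sim_mono, rule IH)
             apply assumption
            apply (simp add: test_def body_def)
          subgoal premises
            by simp
          apply (clarify elim!: loop_relE)
          subgoal for z s' t z' t' d st'
            apply (rule loop_relI[where d="Suc (size x + t1 + (t2 + d))"], simp, assumption, rule refl)
            \<comment> \<open>If the remaining iterations exceed the limit, so does the whole run.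
              Otherwise the body and all remaining iterations together form the second piece for
              \<open>budget\<close>, with time estimate \<open>t2' + d * G\<close>.\<close>
            apply (cases "m < size st2 + c * d")
             apply (rule conjI)
              apply (simp add: distrib_left)
             apply (rule disjI1)
             apply (simp add: distrib_left)
            apply (rule budget[where ?t2'="t2' + d * G" and ?t1'=t1' and ?st1.0="size st1"], assumption)
               apply (simp add: distrib_left distrib_right; elim disjE; linarith)
              apply assumption
             apply (simp add: distrib_left)
            subgoal premises p
              using p f[of t1'] by simp
            done
          done
        done
      done
    then show "sim (case z of (x, st, t0, f, e) \<Rightarrow> loop_rel t0 (f 0 + e 0) st)
        (bind_spmf (run H C x s) (\<lambda>(b, s1, t1).
          if b = Leaf then return_spmf (x, s1, t + cost x + t1)
          else bind_spmf (run H P x s1) (\<lambda>(y, s2, t2). w y s2 (t + cost x + t1 + t2))))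
        (case z of (x, st, t0, f, e) \<Rightarrow> ?start x st f e)"
      by (simp add: z)
  qed (use I f in auto)
  then show ?thesis by simp
qed

lemma simulation_While:
  assumes C: "\<And>x s st. I s st \<Longrightarrow> sim (rel st) (run H C x s) (exec (compile Or C) (Node x st))"
    and P: "\<And>x s st. I s st \<Longrightarrow> sim (rel st) (run H P x s) (exec (compile Or P) (Node x st))"
    and I: "I s st"
  shows "sim (rel st) (run H (While C P) x s) (exec (compile Or (While C P)) (Node x st))"
proof -
  let ?body = "Comp (Pair (compile Or C) Fst) (Comp (compile Or P) resume)"
  let ?Q = "Comp (While (Comp Fst Fst) ?body) (Pair (compile Or C) Fst)"
  \<comment> \<open>One \<open>cost\<close> each for the \<open>Comp\<close>, the
    \<open>Pair\<close> and the \<open>Fst\<close> that set up the loop.\<close>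
  let ?N = "cost (Node x st) + cost (Node x st) + cost (Node x st)"
  have Q: "exec ?Q (Node x st) = bind_spmf (exec (compile Or C) (Node x st)) (\<lambda>(w, t1).
      bind_spmf (exec_loop (Comp Fst Fst) ?body (Node w x) 0) (\<lambda>(z, t2). return_spmf (z, t2 + (?N + t1))))"
    by (simp add: case_prod_unfold algebra_simps)
  have "sim (loop_rel 0 ?N st) (run H (While C P) x s) (exec ?Q (Node x st))"
    using simulation_while_loop[where f="\<lambda>_. 0" and e="\<lambda>t1. ?N + t1", OF C P I] unfolding Q by simp
  then have "sim (\<lambda>a b. loop_rel 0 ?N st a b \<and> a \<in> set_spmf (run H (While C P) x s))
      (run H (While C P) x s) (exec ?Q (Node x st))"
    by (rule sim_restrict) simp
  then have "sim (rel st) (bind_spmf (run H (While C P) x s) return_spmf) (bind_spmf (exec ?Q (Node x st))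
      (\<lambda>(z, t). bind_spmf (exec resume z) (\<lambda>(y, t'). return_spmf (y, cost (Node x st) + t + t'))))"
    apply (rule sim_bind)
    apply (clarify elim!: loop_relE dest!: run_size)
    apply simp
    apply (rule sim_return)
    apply (rule relI, assumption, rule refl, rule conjI, assumption)
    subgoal premises p for y s' z d st'
    \<comment> \<open>Below the limit, the reserve \<open>500 * (m + 1)\<close> covers the set-up
      \<open>?N\<close>, the outer \<open>Comp\<close> and the final \<open>resume\<close>.\<close>
    proof (cases "m < size st + c * d")
      case False
      then have "d \<le> m" "size st \<le> m" using le_c[of d] by linarith+
      with False p show ?thesis by simp
    qed simp
    done
  also have "(bind_spmf (exec ?Q (Node x st))
      (\<lambda>(z, t). bind_spmf (exec resume z) (\<lambda>(y, t'). return_spmf (y, cost (Node x st) + t + t'))))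
    = exec (compile Or (While C P)) (Node x st)"
    by (simp only: exec_simps compile.simps)
  finally show ?thesis by simp
qed

lemma simulation:
  "I s st \<Longrightarrow> sim (rel st) (run H P x s) (exec (compile Or P) (Node x st))"
proof (induction P arbitrary: x s st)
  case (Call i)
  have "sim (rel st) (bind_spmf (spmf_of_pmf (H i x s)) (\<lambda>(y, s'). return_spmf (y, s', cost x + size y)))
     (bind_spmf (exec (Or i) (Node x st)) return_spmf)"
    apply (rule sim_bind[OF query[OF Call]])
    apply (clarsimp intro!: sim_return)
    \<comment> \<open>A call is charged at least one unit, which pays for \<open>G\<close>; if query
      and state exceed \<open>m\<close>, so does the potential size, by \<open>le_c\<close>.\<close>
    subgoal premises p for y s' t' st'
      using p le_c[of "size x + size y"] c by linarith
    done
  then show ?case by (simp add: map_spmf_conv_bind_spmf case_prod_unfold)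
next
  case Flip
  have "sim (rel st) (bind_spmf coin_spmf (\<lambda>b. return_spmf (enc b, s, Suc (size x + 1))))
     (bind_spmf coin_spmf (\<lambda>b. return_spmf (Node (enc b) st, 3 * cost (Node x st) + 1)))"
    by (rule sim_bind[OF rel_spmf_imp_sim[of "(=)"]])
      (auto simp: option.rel_eq pmf.rel_eq simp del: add_Suc_right intro!: simulation_return[OF Flip])
  then show ?case by (simp add: map_spmf_conv_bind_spmf numeral_eq_Suc add_ac)
next
  case Ident
  then show ?case using simulation_return[of s st x 0 _ x] by simp
next
  case (Const d)
  then show ?case using simulation_return[of s st x "size d" _ d] by simp
next
  case Fst
  then show ?case using simulation_return[of s st x 0 _ "left x"] by (cases x) simp_all
next
  case Snd
  then show ?case using simulation_return[of s st x 0 _ "right x"] by (cases x) simp_all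
next
  case Eq
  then show ?case using simulation_return[of s st x 1 _ "enc (left x = right x)"] by (simp add: enc_bool_def)
next
  case (Pair P Q)
  show ?case by (rule simulation_Pair[OF Pair.IH Pair.prems])
next
  case (Comp P Q)
  show ?case by (rule simulation_Comp[OF Comp.IH Comp.prems])
next
  case (Cond C P Q)
  show ?case by (rule simulation_Cond[OF Cond.IH Cond.prems])
next
  case (While C P)
  show ?case by (rule simulation_While[OF While.IH While.prems])
qed

end

section \<open>Polynomial-time functions on trees\<close>

lemma poly_nat_mono: "x \<le> y \<Longrightarrow> poly p x \<le> poly (p :: nat poly) y"
  by (induction p) (auto intro!: mult_mono)

definition computes :: "unit prog \<Rightarrow> data \<Rightarrow> data pmf \<Rightarrow> nat \<Rightarrow> bool" where
  "computes P x D T \<longleftrightarrow> map_spmf fst (exec P x) = spmf_of_pmf D \<and> (\<forall>(y, t) \<in> set_spmf (exec P x). t \<le> T)"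

lemma computes_mono: "computes P x D T \<Longrightarrow> T \<le> T' \<Longrightarrow> computes P x D T'"
  by (fastforce simp: computes_def)

lemma computes_support:
  assumes "computes P x D T"
  shows "fst ` set_spmf (exec P x) = set_pmf D"
  using arg_cong[OF conjunct1[OF assms[unfolded computes_def]], of set_spmf] by simp

lemma computes_size:
  assumes "computes P x D T" "y \<in> set_pmf D"
  shows "size y \<le> T"
proof -
  obtain t where "(y, t) \<in> set_spmf (exec P x)"
    using computes_support[OF assms(1)] assms(2) by force
  then show ?thesis using exec_size[of y t P x] assms(1) by (fastforce simp: computes_def)
qed

lemma computes_return:
  "exec P x = return_spmf (y, t) \<Longrightarrow> t \<le> T \<Longrightarrow> computes P x (return_pmf y) T"
  by (simp add: computes_def)

lemma bind_exec:
  assumes "computes P x D T"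
  shows "bind_spmf (exec P x) (\<lambda>(y, t). g y) = bind_spmf (spmf_of_pmf D) g"
proof -
  have "bind_spmf (exec P x) (\<lambda>(y, t). g y) = bind_spmf (map_spmf fst (exec P x)) g"
    by (simp add: bind_map_spmf o_def case_prod_unfold)
  then show ?thesis using assms by (simp add: computes_def)
qed

lemma computes_Comp:
  assumes Q: "computes Q x D T1" and P: "\<And>y. y \<in> set_pmf D \<Longrightarrow> computes P y (E y) T2"
  shows "computes (Comp P Q) x (bind_pmf D E) (cost x + T1 + T2)"
  unfolding computes_def
proof (intro conjI ballI)
  have "map_spmf fst (exec (Comp P Q) x) =
      bind_spmf (exec Q x) (\<lambda>(y, t). map_spmf fst (exec P y))"
    by (simp add: map_spmf_bind_spmf o_def case_prod_unfold map_spmf_conv_bind_spmf)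
  also have "\<dots> = bind_spmf (spmf_of_pmf D) (\<lambda>y. map_spmf fst (exec P y))"
    by (rule bind_exec[OF Q])
  also have "\<dots> = bind_spmf (spmf_of_pmf D) (\<lambda>y. spmf_of_pmf (E y))"
    using P by (intro bind_spmf_cong) (auto simp: computes_def)
  finally show "map_spmf fst (exec (Comp P Q) x) = spmf_of_pmf (bind_pmf D E)"
    by (simp add: spmf_of_pmf_bind)
  fix r assume "r \<in> set_spmf (exec (Comp P Q) x)"
  then obtain y t1 z t2 where *: "(y, t1) \<in> set_spmf (exec Q x)" "(z, t2) \<in> set_spmf (exec P y)"
    "r = (z, cost x + t1 + t2)"
    by (auto simp: set_bind_spmf)
  moreover have "y \<in> set_pmf D" using computes_support[OF Q] *(1) by force
  ultimately show "case r of (y, t) \<Rightarrow> t \<le> cost x + T1 + T2"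
    using Q P[of y] unfolding computes_def by (fastforce intro: add_mono)
qed

lemma computes_Pair:
  assumes P: "computes P x D T1" and Q: "computes Q x E T2"
  shows "computes (Pair P Q) x (bind_pmf D (\<lambda>y. map_pmf (Node y) E)) (cost x + T1 + T2)"
  unfolding computes_def
proof (intro conjI ballI)
  have "map_spmf fst (exec (Pair P Q) x) =
      bind_spmf (exec P x) (\<lambda>(y, t). bind_spmf (exec Q x) (\<lambda>(z, t). return_spmf (Node y z)))"
    by (simp add: map_spmf_bind_spmf o_def case_prod_unfold)
  also have "\<dots> = bind_spmf (spmf_of_pmf D) (\<lambda>y. bind_spmf (spmf_of_pmf E) (\<lambda>z. return_spmf (Node y z)))"
    by (simp only: bind_exec[OF P] bind_exec[OF Q])
  finally show "map_spmf fst (exec (Pair P Q) x) = spmf_of_pmf (bind_pmf D (\<lambda>y. map_pmf (Node y) E))"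
    by (simp add: spmf_of_pmf_bind map_pmf_def)
  fix r assume "r \<in> set_spmf (exec (Pair P Q) x)"
  then obtain y t1 z t2 where *: "(y, t1) \<in> set_spmf (exec P x)" "(z, t2) \<in> set_spmf (exec Q x)"
    "r = (Node y z, cost x + t1 + t2)"
    by (auto simp: set_bind_spmf)
  then show "case r of (y, t) \<Rightarrow> t \<le> cost x + T1 + T2"
    using Q P unfolding computes_def by (fastforce intro: add_mono)
qed

lemma computes_Cond:
  assumes C: "computes C x (return_pmf b) T1"
    and P: "b \<noteq> Leaf \<Longrightarrow> computes P x D T2" and Q: "b = Leaf \<Longrightarrow> computes Q x E T2"
  shows "computes (Cond C P Q) x (if b \<noteq> Leaf then D else E) (cost x + T1 + T2)"
  unfolding computes_def
proof (intro conjI ballI)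
  have "map_spmf fst (exec (Cond C P Q) x) =
      bind_spmf (exec C x) (\<lambda>(b, t). map_spmf fst (if b = Leaf then exec Q x else exec P x))"
    by (simp add: map_spmf_bind_spmf o_def case_prod_unfold map_spmf_conv_bind_spmf)
  also have "\<dots> = map_spmf fst (if b = Leaf then exec Q x else exec P x)"
    by (simp only: bind_exec[OF C]) simp
  finally show "map_spmf fst (exec (Cond C P Q) x) = spmf_of_pmf (if b \<noteq> Leaf then D else E)"
    using P Q by (auto simp: computes_def)
  fix r assume "r \<in> set_spmf (exec (Cond C P Q) x)"
  then obtain b' t1 z t2 where *: "(b', t1) \<in> set_spmf (exec C x)"
    "(z, t2) \<in> set_spmf (if b' = Leaf then exec Q x else exec P x)" "r = (z, cost x + t1 + t2)"
    by (auto simp: set_bind_spmf)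
  moreover have "b' = b" using computes_support[OF C] *(1) by force
  ultimately show "case r of (y, t) \<Rightarrow> t \<le> cost x + T1 + T2"
    using C P Q unfolding computes_def by (cases "b = Leaf") (fastforce intro: add_mono)+
qed

text \<open>The set \<open>X\<close> reflects that algorithms are specified on correct encodings
  only, and that the compiled adversary is bounded only on honestly generated inputs.\<close>

definition ptime :: "data set \<Rightarrow> (data \<Rightarrow> data pmf) \<Rightarrow> bool" where
  "ptime X f \<longleftrightarrow> (\<exists>P p. \<forall>x \<in> X. computes P x (f x) (poly p (size x)))"

lemma ptime_cong: "ptime X g \<Longrightarrow> (\<And>x. x \<in> X \<Longrightarrow> f x = g x) \<Longrightarrow> ptime X f"
  by (simp add: ptime_def)

lemma ptime_subset: "ptime Y f \<Longrightarrow> X \<subseteq> Y \<Longrightarrow> ptime X f"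
  unfolding ptime_def by blast

lemma ptime_size:
  assumes "ptime X f"
  obtains p where "\<And>x y. x \<in> X \<Longrightarrow> y \<in> set_pmf (f x) \<Longrightarrow> size y \<le> poly p (size x)"
  using assms computes_size unfolding ptime_def by meson

text \<open>The result of the first program is no larger than its running time, hence the composed
  polynomial; \<open>[:1, 1:]\<close> is the cost of reading the input.\<close>

lemma ptime_comp:
  assumes f: "ptime X f" and g: "ptime Y g" and XY: "\<And>x y. x \<in> X \<Longrightarrow> y \<in> set_pmf (f x) \<Longrightarrow> y \<in> Y"
  shows "ptime X (\<lambda>x. bind_pmf (f x) g)"
proof -
  from f obtain P p where P: "\<And>x. x \<in> X \<Longrightarrow> computes P x (f x) (poly p (size x))"
    unfolding ptime_def by blast
  from g obtain Q q where Q: "\<And>x. x \<in> Y \<Longrightarrow> computes Q x (g x) (poly q (size x))"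
    unfolding ptime_def by blast
  have "computes (Comp Q P) x (bind_pmf (f x) g) (poly ([:1, 1:] + p + pcompose q p) (size x))" if "x \<in> X" for x
  proof (rule computes_mono[OF computes_Comp[OF P[OF that]]])
    fix y assume y: "y \<in> set_pmf (f x)"
    show "computes Q y (g y) (poly q (poly p (size x)))"
      by (rule computes_mono[OF Q[OF XY[OF that y]] poly_nat_mono[OF computes_size[OF P[OF that] y]]])
  qed (simp add: poly_pcompose)
  then show ?thesis unfolding ptime_def by blast
qed

lemma ptime_pair:
  assumes f: "ptime X f" and g: "ptime X g"
  shows "ptime X (\<lambda>x. bind_pmf (f x) (\<lambda>y. map_pmf (Node y) (g x)))"
proof -
  from f obtain P p where P: "\<And>x. x \<in> X \<Longrightarrow> computes P x (f x) (poly p (size x))"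
    unfolding ptime_def by blast
  from g obtain Q q where Q: "\<And>x. x \<in> X \<Longrightarrow> computes Q x (g x) (poly q (size x))"
    unfolding ptime_def by blast
  have "computes (Pair P Q) x (bind_pmf (f x) (\<lambda>y. map_pmf (Node y) (g x))) (poly ([:1, 1:] + p + q) (size x))"
    if "x \<in> X" for x
    using computes_Pair[OF P Q, OF that that] by (rule computes_mono) simp
  then show ?thesis unfolding ptime_def by blast
qed

abbreviation ptime_det :: "data set \<Rightarrow> (data \<Rightarrow> data) \<Rightarrow> bool" where
  "ptime_det X e \<equiv> ptime X (\<lambda>x. return_pmf (e x))"

lemma det_prog: "(\<And>x. x \<in> X \<Longrightarrow> exec P x = return_spmf (e x, t x)) \<Longrightarrow> (\<And>x. x \<in> X \<Longrightarrow> t x \<le> poly p (size x)) \<Longrightarrow> ptime_det X e"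
  unfolding ptime_def by (intro exI[of _ P] exI[of _ p]) (auto intro: computes_return)

lemma det_comp:
  assumes "ptime_det X e" "ptime Y g" "\<And>x. x \<in> X \<Longrightarrow> e x \<in> Y"
  shows "ptime X (\<lambda>x. g (e x))"
  using ptime_comp[OF assms(1,2)] assms(3) by (simp add: bind_return_pmf)

lemma det_id: "ptime_det X (\<lambda>x. x)"
  by (rule det_prog[where P=Ident and p="[:1, 1:]"]) auto

lemma det_const: "ptime_det X (\<lambda>x. d)"
  by (rule det_prog[where P="Const d" and p="[:1 + size d, 1:]"]) auto

lemma det_left: "ptime_det X e \<Longrightarrow> ptime_det X (\<lambda>x. left (e x))"
  by (erule det_comp[where Y=UNIV and g="\<lambda>x. return_pmf (left x)"])
    (rule det_prog[where P=Fst and p="[:1, 1:]"], auto)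

lemma det_right: "ptime_det X e \<Longrightarrow> ptime_det X (\<lambda>x. right (e x))"
  by (erule det_comp[where Y=UNIV and g="\<lambda>x. return_pmf (right x)"])
    (rule det_prog[where P=Snd and p="[:1, 1:]"], auto)

lemma det_Node: "ptime_det X e \<Longrightarrow> ptime_det X e' \<Longrightarrow> ptime_det X (\<lambda>x. Node (e x) (e' x))"
  using ptime_pair[of X "\<lambda>x. return_pmf (e x)" "\<lambda>x. return_pmf (e' x)"] by (simp add: bind_return_pmf)

text \<open>The input is paired with the sample, so that the continuation sees both. With this rule
  a function in monadic form is shown to be polynomial-time by following its syntax, without writing
  a program.\<close>

lemma ptime_bind:
  assumes f: "ptime X f"
    and g: "ptime {z. left z \<in> X \<and> right z \<in> set_pmf (f (left z))} (\<lambda>z. g (left z) (right z))"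
  shows "ptime X (\<lambda>x. bind_pmf (f x) (g x))"
proof -
  have "ptime X (\<lambda>x. bind_pmf (bind_pmf (return_pmf x) (\<lambda>y. map_pmf (Node y) (f x))) (\<lambda>z. g (left z) (right z)))"
    by (rule ptime_comp[OF ptime_pair[OF det_id f] g]) (auto simp: bind_return_pmf)
  then show ?thesis
    by (simp add: bind_return_pmf bind_map_pmf)
qed

lemma ptime_if:
  assumes c: "ptime_det X c" and cP: "\<And>x. x \<in> X \<Longrightarrow> c x \<noteq> Leaf \<longleftrightarrow> P x"
    and f: "ptime {x \<in> X. P x} f" and g: "ptime {x \<in> X. \<not> P x} g"
  shows "ptime X (\<lambda>x. if P x then f x else g x)"
proof -
  from c obtain C r where C: "\<And>x. x \<in> X \<Longrightarrow> computes C x (return_pmf (c x)) (poly r (size x))"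
    unfolding ptime_def by blast
  from f obtain F p where F: "\<And>x. x \<in> X \<Longrightarrow> P x \<Longrightarrow> computes F x (f x) (poly p (size x))"
    unfolding ptime_def by blast
  from g obtain Q q where Q: "\<And>x. x \<in> X \<Longrightarrow> \<not> P x \<Longrightarrow> computes Q x (g x) (poly q (size x))"
    unfolding ptime_def by blast
  have "computes (Cond C F Q) x (if P x then f x else g x) (poly ([:1, 1:] + r + (p + q)) (size x))"
    if "x \<in> X" for x
  proof -
    have "computes (Cond C F Q) x (if c x \<noteq> Leaf then f x else g x)
      (cost x + poly r (size x) + (poly p (size x) + poly q (size x)))"
      by (rule computes_Cond[OF C[OF that]])
        (use cP[OF that] in \<open>auto intro: computes_mono[OF F[OF that]] computes_mono[OF Q[OF that]]\<close>)
    then show ?thesis using cP[OF that] by simp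
  qed
  then show ?thesis unfolding ptime_def by blast
qed

lemma size_enc_nat [simp]: "size (enc (n :: nat)) = n"
  by (induction n) auto

text \<open>Makes the given algorithms callable as subroutines: it suffices that the encoding of
  their arguments can be computed.\<close>

lemma ptime_ppt:
  fixes f :: "nat \<Rightarrow> 'a::encodable \<Rightarrow> 'b::encodable pmf"
  assumes "ppt f" "ptime_det X (\<lambda>x. enc (n x, v x))"
  shows "ptime X (\<lambda>x. map_pmf enc (f (n x) (v x)))"
proof -
  from assms(1) obtain P :: "unit prog" and p :: "nat poly" where P: "\<forall>\<eta> x.
     map_spmf fst (run (\<lambda>_ _ s. return_pmf (Leaf, s)) P (enc (\<eta>, x)) ()) = spmf_of_pmf (map_pmf enc (f \<eta> x)) \<and>
        (\<forall>(y, s, t) \<in> set_spmf (run (\<lambda>_ _ s. return_pmf (Leaf, s)) P (enc (\<eta>, x)) ()). t \<le> poly p (\<eta> + size (enc x)))"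
    unfolding ppt_def Let_def by (elim exE) (rule that)
  have "computes P (enc (\<eta>, x)) (map_pmf enc (f \<eta> x)) (poly p (size (enc (\<eta>, x))))" for \<eta> x
  proof (rule computes_mono)
    show "computes P (enc (\<eta>, x)) (map_pmf enc (f \<eta> x)) (poly p (\<eta> + size (enc x)))"
      using P[rule_format, of \<eta> x] by (auto simp: computes_def exec_def spmf.map_comp o_def case_prod_unfold)
    show "poly p (\<eta> + size (enc x)) \<le> poly p (size (enc (\<eta>, x)))"
      by (rule poly_nat_mono) (simp add: enc_prod_def)
  qed
  then have *: "ptime (range (enc :: nat \<times> 'a \<Rightarrow> data)) (\<lambda>z. map_pmf enc (case inv enc z of (\<eta>, x) \<Rightarrow> f \<eta> x))"
    unfolding ptime_def by (intro exI[of _ P] exI[of _ p]) (auto simp: inv_f_f[OF inj_enc])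
  show ?thesis
    using det_comp[OF assms(2) *] by (simp add: inv_f_f[OF inj_enc])
qed

lemma det_poly_time:
  fixes f :: "nat \<Rightarrow> 'a::encodable \<Rightarrow> 'b::encodable"
  assumes "poly_time f" "ptime_det X (\<lambda>x. enc (n x, v x))"
  shows "ptime_det X (\<lambda>x. enc (f (n x) (v x)))"
  using ptime_ppt[OF assms(1)[unfolded poly_time_def] assms(2)] by simp

lemma ptime_imp_ppt:
  fixes f :: "nat \<Rightarrow> 'a::encodable \<Rightarrow> 'b::encodable pmf"
  assumes "ptime (range (enc :: nat \<times> 'a \<Rightarrow> data)) F" "\<And>\<eta> x. F (enc (\<eta>, x)) = map_pmf enc (f \<eta> x)"
  shows "ppt f"
proof -
  from assms(1) obtain P p where P: "\<And>x. x \<in> range (enc :: nat \<times> 'a \<Rightarrow> data) \<Longrightarrow> computes P x (F x) (poly p (size x))"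
    unfolding ptime_def by blast
  show ?thesis
    unfolding ppt_def Let_def
  \<comment> \<open>The node that forms the pair adds one to the size, hence the shifted
    polynomial.\<close>
  proof (intro exI[of _ P] exI[of _ "pcompose p [:1, 1:]"] allI conjI ballI)
    fix \<eta> :: nat and x :: 'a
    from P[of "enc (\<eta>, x)"] have *: "computes P (enc (\<eta>, x)) (map_pmf enc (f \<eta> x)) (poly p (size (enc (\<eta>, x))))"
      by (simp add: assms(2))
    then show "map_spmf fst (run (\<lambda>_ _ s. return_pmf (Leaf, s)) P (enc (\<eta>, x)) ()) = spmf_of_pmf (map_pmf enc (f \<eta> x))"
      by (simp add: computes_def exec_def spmf.map_comp o_def case_prod_unfold)
    fix r assume "r \<in> set_spmf (run (\<lambda>_ _ s. return_pmf (Leaf, s)) P (enc (\<eta>, x)) ())"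
    with * show "case r of (y, s, t) \<Rightarrow> t \<le> poly (pcompose p [:1, 1:]) (\<eta> + size (enc x))"
      by (fastforce simp: computes_def exec_def case_prod_unfold poly_pcompose enc_prod_def)
  qed
qed

section \<open>Association lists\<close>

fun lookup :: "data \<Rightarrow> data \<Rightarrow> data" where
  "lookup k Leaf = Leaf"
| "lookup k (Node e L) = (if left e = k then Node Leaf (right e) else lookup k L)"

text \<open>This is what a loop that drops entries can compute: the rest of the list from the first
  match on, from whose head \<open>lookup\<close> takes the value.\<close>

fun find_entry :: "data \<Rightarrow> data \<Rightarrow> data" where
  "find_entry k Leaf = Leaf"
| "find_entry k (Node e L) = (if left e = k then Node e L else find_entry k L)"

lemma size_left: "size (left x) \<le> size x"
  by (cases x) simp_all

lemma lookup_loop: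
  fixes k :: data
  defines "test \<equiv> Cond Snd (Cond (Comp Eq (Pair Fst (Comp Fst (Comp Fst Snd)))) (Const Leaf) (Const (Node Leaf Leaf)))
    (Const Leaf)" and "body \<equiv> Pair Fst (Comp Snd Snd)"
  shows "\<exists>t'. exec_loop test body (Node k L) t = return_spmf (Node k (find_entry k L), t') \<and>
    t' \<le> t + Suc (size L) * (1000 * (size k + size L + 1))"
proof (induction L arbitrary: t)
  case Leaf
  show ?case
    by (subst exec_loop_unfold) (simp add: test_def)
next
  case (Node e L)
  show ?case
  proof (cases "left e = k")
    case True
    then show ?thesis
      using size_left[of e] by (subst exec_loop_unfold) (simp add: test_def enc_bool_def)
  next
    case False
    let ?N = "1000 * (size k + size (Node e L) + 1)"
    have "\<exists>t1. exec_loop test body (Node k (Node e L)) t = exec_loop test body (Node k L) t1 \<and> t1 \<le> t + ?N"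
      using False size_left[of e] unfolding test_def body_def
      by (subst exec_loop_unfold) (simp add: enc_bool_def, rule exI, rule conjI, rule refl, simp)
    then obtain t1 where *: "exec_loop test body (Node k (Node e L)) t = exec_loop test body (Node k L) t1" "t1 \<le> t + ?N"
      by blast
    from Node.IH(2)[of t1] obtain t' where
      "exec_loop test body (Node k L) t1 = return_spmf (Node k (find_entry k L), t')"
      "t' \<le> t1 + Suc (size L) * (1000 * (size k + size L + 1))" by blast
    moreover have "Suc (size L) * (1000 * (size k + size L + 1)) \<le> size (Node e L) * ?N"
      by (intro mult_mono) auto
    ultimately show ?thesis using * False by auto
  qed
qed

lemma lookup_conv_find_entry:
  "lookup k L = (if find_entry k L \<noteq> Leaf then Node Leaf (right (left (find_entry k L))) else Leaf)"
  by (induction k L rule: lookup.induct) auto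

lemma det_find_entry:
  assumes "ptime_det X k" "ptime_det X L"
  shows "ptime_det X (\<lambda>x. find_entry (k x) (L x))"
proof -
  have "ptime {z. z \<noteq> Leaf} (\<lambda>z. return_pmf (Node (left z) (find_entry (left z) (right z))))"
    unfolding ptime_def
  proof (intro exI ballI)
    fix z assume "z \<in> {z. z \<noteq> Leaf}"
    then obtain k L where z: "z = Node k L" by (cases z) auto
    obtain P :: "unit prog" where P: "P = While (Cond Snd (Cond (Comp Eq (Pair Fst (Comp Fst (Comp Fst Snd)))) (Const Leaf) (Const (Node Leaf Leaf)))
      (Const Leaf)) (Pair Fst (Comp Snd Snd))" by blast
    obtain t' where *: "exec P z = return_spmf (Node k (find_entry k L), t')"
      "t' \<le> 0 + Suc (size L) * (1000 * (size k + size L + 1))"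
      using lookup_loop[of k L 0] by (auto simp: P z)
    have "t' \<le> Suc (size z) * (1000 * (size z + 1))"
      using *(2) by (rule order.trans) (simp only: z add_0, intro mult_mono; simp)
    \<comment> \<open>The polynomial is \<open>1000 * (n + 1) ^ 2\<close>, expanded.\<close>
    then have "t' \<le> poly [:1000, 2000, 1000:] (size z)"
      by (simp add: algebra_simps)
    with *(1) show "computes (While (Cond Snd (Cond (Comp Eq (Pair Fst (Comp Fst (Comp Fst Snd)))) (Const Leaf)
        (Const (Node Leaf Leaf))) (Const Leaf)) (Pair Fst (Comp Snd Snd))) z
      (return_pmf (Node (left z) (find_entry (left z) (right z)))) (poly [:1000, 2000, 1000:] (size z))"
      by (intro computes_return) (auto simp: z P)
  qed
  from det_right[OF det_comp[OF det_Node[OF assms] this]] show ?thesis by simp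
qed

lemma det_lookup:
  assumes "ptime_det X k" "ptime_det X L"
  shows "ptime_det X (\<lambda>x. lookup (k x) (L x))"
proof -
  have "ptime X (\<lambda>x. if find_entry (k x) (L x) \<noteq> Leaf
      then return_pmf (Node Leaf (right (left (find_entry (k x) (L x))))) else return_pmf Leaf)"
    by (rule ptime_if[where c="\<lambda>x. find_entry (k x) (L x)"])
      (auto intro!: det_find_entry assms det_Node det_const det_right det_left intro: ptime_subset[OF assms(1)] ptime_subset[OF assms(2)])
  then show ?thesis
    by (rule ptime_cong) (simp add: lookup_conv_find_entry[of "k _"])
qed

section \<open>The oracles of the experiment\<close>

lemma det_enc_bool_neq_Leaf:
  assumes "ptime_det X e"
  shows "ptime_det X (\<lambda>x. enc (e x \<noteq> Leaf))"
proof -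
  have "ptime X (\<lambda>x. if e x \<noteq> Leaf then return_pmf (enc True) else return_pmf (enc False))"
    by (rule ptime_if[OF assms]) (auto intro: det_const)
  then show ?thesis by (rule ptime_cong) auto
qed

lemma det_if:
  assumes "ptime_det X (\<lambda>x. enc (P x))" "ptime_det {x \<in> X. P x} e" "ptime_det {x \<in> X. \<not> P x} e'"
  shows "ptime_det X (\<lambda>x. if P x then e x else e' x)"
  using ptime_if[OF assms(1) _ assms(2,3)]
  by (simp add: enc_bool_def if_distrib[of return_pmf, symmetric])

lemma det_enc_conj: "ptime_det X (\<lambda>x. enc (P x)) \<Longrightarrow> ptime_det X (\<lambda>x. enc (Q x)) \<Longrightarrow> ptime_det X (\<lambda>x. enc (P x \<and> Q x))"
  using det_if[of X P "\<lambda>x. enc (Q x)" "\<lambda>x. enc False"] ptime_subset[of X "\<lambda>x. return_pmf (enc (Q x))" "{x \<in> X. P x}"]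
  by (auto simp: det_const intro!: ptime_cong[of X "\<lambda>x. return_pmf (if P x then enc (Q x) else enc False)"])

lemma det_enc_not: "ptime_det X (\<lambda>x. enc (P x)) \<Longrightarrow> ptime_det X (\<lambda>x. enc (\<not> P x))"
  using det_if[of X P "\<lambda>x. enc False" "\<lambda>x. enc True"]
  by (auto simp: det_const intro!: ptime_cong[of X "\<lambda>x. return_pmf (if P x then enc False else enc True)"])

lemma det_enc_eq_Leaf: "ptime_det X e \<Longrightarrow> ptime_det X (\<lambda>x. enc (e x = Leaf))"
  using det_enc_not[OF det_enc_bool_neq_Leaf[of X e]] by simp

lemma ptime_if_bool:
  assumes "ptime_det X (\<lambda>x. enc (P x))" "ptime {x \<in> X. P x} f" "ptime {x \<in> X. \<not> P x} g"
  shows "ptime X (\<lambda>x. if P x then f x else g x)"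
  by (rule ptime_if[OF assms(1) _ assms(2,3)]) (simp add: enc_bool_def)

definition num :: "data \<Rightarrow> nat" where "num = inv enc"

lemma num_enc [simp]: "num (enc n) = n"
  by (simp add: num_def inv_f_f[OF inj_enc])

lemma enc_data [simp]: "enc (x :: data) = x"
  by (simp add: enc_data_def)

lemma enc_Pair [simp]: "enc (x, y) = Node (enc x) (enc y)"
  by (simp add: enc_prod_def)

lemma map_pmf_enc_data [simp]: "map_pmf enc (D :: data pmf) = D"
  by (simp add: enc_data_def[abs_def])

text \<open>On correct encodings this is the identity, so the security parameter can be passed on as
  found in a tree. The range condition recurs in the rules for the algorithms.\<close>

lemma det_enc_num: "ptime_det X N \<Longrightarrow> N ` X \<subseteq> range (enc :: nat \<Rightarrow> data) \<Longrightarrow> ptime_det X (\<lambda>x. enc (num (N x)))"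
  by (erule ptime_cong) auto

lemmas det_intros = det_const det_id det_left det_right det_Node det_lookup det_enc_bool_neq_Leaf
  det_enc_eq_Leaf det_enc_conj det_enc_not

text \<open>
  In the association list, the tags 0 to 4 stand for \<open>CU\<close>, \<open>USK\<close>, \<open>ver\<close>, \<open>REG\<close> and \<open>COMM\<close>; the latter
  maps a comment to its message. \<open>HU\<close> need not be stored: it is the domain of \<open>USK\<close> without \<open>CU\<close>.
\<close>

definition key :: "nat \<Rightarrow> data \<Rightarrow> data" where "key n d = Node (enc n) d"
definition get :: "data \<Rightarrow> data \<Rightarrow> data" where "get k st = lookup k (right st)"
text \<open>Entries are never removed: a new one shadows older ones with its key, and an update adds
  little more than the sizes of key and value, whatever the history.\<close>

definition put :: "data \<Rightarrow> data \<Rightarrow> data \<Rightarrow> data" where "put k v st = Node (left st) (Node (Node k v) (right st))"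

lemma key_eq_iff [simp]: "key n d = key n' d' \<longleftrightarrow> n = n' \<and> d = d'"
  by (simp add: key_def inj_eq[OF inj_enc])

lemma size_key [simp]: "size (key n d) = Suc (n + size d)"
  by (simp add: key_def)

lemma get_put [simp]: "get k (put k' v st) = (if k = k' then Node Leaf v else get k st)"
  by (simp add: get_def put_def)

lemma left_put [simp]: "left (put k v st) = left st"
  by (simp add: put_def)

lemma size_put: "size (put k v st) \<le> size st + size k + size v + 3"
  by (cases st) (simp_all add: put_def)

lemma rel_pmf_bind_reflI:
  "(\<And>x. x \<in> set_pmf p \<Longrightarrow> rel_pmf R (f x) (g x)) \<Longrightarrow> rel_pmf R (bind_pmf p f) (bind_pmf p g)"
  by (rule rel_pmf_bindI[where R="\<lambda>x y. x = y \<and> x \<in> set_pmf p"]) (auto intro: rel_pmf_reflI)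

locale trollthrottle =
  fixes D :: daa and Z :: nizk and h :: "nat \<Rightarrow> data \<Rightarrow> data"
  assumes hash: "poly_time h" and daa: "is_daa D" and linkable: "instantly_linkable D"
    and pok: "proof_of_knowledge Z (R_join D)"
begin

text \<open>A state is a pair of an environment, which holds the security parameter, the reference string and
  the issuer key pair, and an association list.\<close>

abbreviation "param \<equiv> \<lambda>e. num (left e)"
abbreviation "crs \<equiv> \<lambda>e. left (right e)"
abbreviation "pkI \<equiv> \<lambda>e. left (right (right e))"
abbreviation "skI \<equiv> \<lambda>e. right (right (right e))"

section \<open>The algorithms of the scheme as polynomial-time functions on trees\<close>

definition join_issue_data :: "data \<Rightarrow> data pmf" where
  "join_issue_data e = map_pmf enc (tt_join_issue D Z (param e, crs e) (pkI e) (pkI e, skI e))"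

definition issue_data :: "data \<Rightarrow> data \<Rightarrow> data pmf" where
  "issue_data e x = map_pmf enc (tt_issue D Z (param e, crs e) (pkI e, skI e) (left x, right x))"

lemma ptime_user_key:
  "ptime_det X N \<Longrightarrow> N ` X \<subseteq> range (enc :: nat \<Rightarrow> data) \<Longrightarrow> ptime_det X a \<Longrightarrow> ptime X (\<lambda>x. daa_user_key D (num (N x)) (a x))"
  using ptime_ppt[of "daa_user_key D" X "\<lambda>x. num (N x)" a] daa
  by (simp add: is_daa_def det_Node det_enc_num)

lemma ptime_join_coins:
  "ptime_det X N \<Longrightarrow> N ` X \<subseteq> range (enc :: nat \<Rightarrow> data) \<Longrightarrow> ptime_det X a \<Longrightarrow> ptime X (\<lambda>x. daa_join_coins D (num (N x)) (a x))"
  using ptime_ppt[of "daa_join_coins D" X "\<lambda>x. num (N x)" a] daa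
  by (simp add: is_daa_def det_Node det_enc_num)

lemma det_join:
  "ptime_det X N \<Longrightarrow> N ` X \<subseteq> range (enc :: nat \<Rightarrow> data) \<Longrightarrow> ptime_det X a \<Longrightarrow> ptime_det X b \<Longrightarrow> ptime_det X r \<Longrightarrow>
    ptime_det X (\<lambda>x. daa_join D (num (N x)) (a x) (b x) (r x))"
  using det_poly_time[of "\<lambda>\<eta> (pk, sk, r). daa_join D \<eta> pk sk r" X "\<lambda>x. num (N x)" "\<lambda>x. (a x, b x, r x)"] daa
  by (simp add: is_daa_def det_Node det_enc_num)

lemma ptime_issue:
  "ptime_det X N \<Longrightarrow> N ` X \<subseteq> range (enc :: nat \<Rightarrow> data) \<Longrightarrow> ptime_det X a \<Longrightarrow> ptime_det X b \<Longrightarrow>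
    ptime X (\<lambda>x. daa_issue D (num (N x)) (a x) (b x))"
  using ptime_ppt[of "\<lambda>\<eta> (skI, com). daa_issue D \<eta> skI com" X "\<lambda>x. num (N x)" "\<lambda>x. (a x, b x)"] daa
  by (simp add: is_daa_def det_Node det_enc_num)

lemma ptime_sign:
  "ptime_det X N \<Longrightarrow> N ` X \<subseteq> range (enc :: nat \<Rightarrow> data) \<Longrightarrow> ptime_det X a \<Longrightarrow> ptime_det X b \<Longrightarrow> ptime_det X c \<Longrightarrow> ptime_det X d \<Longrightarrow>
    ptime X (\<lambda>x. daa_sign D (num (N x)) (a x) (b x) (c x) (d x))"
  using ptime_ppt[of "\<lambda>\<eta> (sk, cred, bsn, m). daa_sign D \<eta> sk cred bsn m" X "\<lambda>x. num (N x)" "\<lambda>x. (a x, b x, c x, d x)"] daa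
  by (simp add: is_daa_def det_Node det_enc_num)

lemma det_nym_gen:
  "ptime_det X N \<Longrightarrow> N ` X \<subseteq> range (enc :: nat \<Rightarrow> data) \<Longrightarrow> ptime_det X a \<Longrightarrow> ptime_det X b \<Longrightarrow>
    ptime_det X (\<lambda>x. nym_gen D (num (N x)) (a x) (b x))"
  using det_poly_time[of "\<lambda>\<eta> (sk, bsn). nym_gen D \<eta> sk bsn" X "\<lambda>x. num (N x)" "\<lambda>x. (a x, b x)"] linkable
  by (simp add: instantly_linkable_def det_Node det_enc_num)

lemma det_hash:
  "ptime_det X N \<Longrightarrow> N ` X \<subseteq> range (enc :: nat \<Rightarrow> data) \<Longrightarrow> ptime_det X a \<Longrightarrow> ptime_det X (\<lambda>x. h (num (N x)) (a x))"
  using det_poly_time[of h X "\<lambda>x. num (N x)" a] hash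
  by (simp add: det_Node det_enc_num)

lemma ptime_prove:
  "ptime_det X N \<Longrightarrow> N ` X \<subseteq> range (enc :: nat \<Rightarrow> data) \<Longrightarrow> ptime_det X a \<Longrightarrow> ptime_det X b \<Longrightarrow> ptime_det X c \<Longrightarrow> ptime_det X d \<Longrightarrow> ptime_det X e \<Longrightarrow>
    ptime X (\<lambda>x. zk_prove Z (num (N x)) (a x) (b x, c x) (d x, e x))"
  using ptime_ppt[of "\<lambda>\<eta> (\<rho>, x, w). zk_prove Z \<eta> \<rho> x w" X "\<lambda>x. num (N x)" "\<lambda>x. (a x, (b x, c x), (d x, e x))"] pok
  by (simp add: proof_of_knowledge_def det_Node det_enc_num)

lemma det_verify:
  "ptime_det X N \<Longrightarrow> N ` X \<subseteq> range (enc :: nat \<Rightarrow> data) \<Longrightarrow> ptime_det X a \<Longrightarrow> ptime_det X b \<Longrightarrow> ptime_det X c \<Longrightarrow> ptime_det X d \<Longrightarrow>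
    ptime_det X (\<lambda>x. enc (zk_verify Z (num (N x)) (a x) (b x, c x) (d x)))"
  using det_poly_time[of "\<lambda>\<eta> (\<rho>, x, \<pi>). zk_verify Z \<eta> \<rho> x \<pi>" X "\<lambda>x. num (N x)" "\<lambda>x. (a x, (b x, c x), d x)"] pok
  by (simp add: proof_of_knowledge_def det_Node det_enc_num)

lemmas algorithm_intros = ptime_user_key ptime_join_coins det_join ptime_issue ptime_sign det_nym_gen det_hash
  ptime_prove det_verify

lemma ptime_join_issue_data: "ptime {e. left e \<in> range (enc :: nat \<Rightarrow> data)} join_issue_data"
proof -
  \<comment> \<open>The commitment is recomputed wherever it occurs, which is sound because
    \<open>daa_join\<close> is deterministic once the coins are fixed.\<close>
  have "ptime {e. left e \<in> range (enc :: nat \<Rightarrow> data)} (\<lambda>e.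
    bind_pmf (daa_user_key D (param e) (pkI e)) (\<lambda>skU.
    bind_pmf (daa_join_coins D (param e) (pkI e)) (\<lambda>r.
    bind_pmf (zk_prove Z (param e) (crs e) (daa_join D (param e) (pkI e) skU r, pkI e) (skU, r)) (\<lambda>\<pi>.
    if zk_verify Z (param e) (crs e) (daa_join D (param e) (pkI e) skU r, pkI e) \<pi>
    then bind_pmf (daa_issue D (param e) (skI e) (daa_join D (param e) (pkI e) skU r)) (\<lambda>cred.
      return_pmf (Node Leaf (Node skU cred)))
    else return_pmf Leaf))))"
    by (intro ptime_bind ptime_if_bool algorithm_intros det_intros) auto
  then show ?thesis
    by (rule ptime_cong) (simp add: join_issue_data_def tt_join_issue_def tt_join_def tt_issue_def
      map_bind_pmf bind_assoc_pmf bind_return_pmf Let_def if_distrib[of "\<lambda>p. bind_pmf p _"]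
      if_distrib[of "map_pmf _"] cong: if_cong)
qed

lemma ptime_issue_data: "ptime {z. left (left z) \<in> range (enc :: nat \<Rightarrow> data)} (\<lambda>z. issue_data (left z) (right z))"
proof -
  have "ptime {z. left (left z) \<in> range (enc :: nat \<Rightarrow> data)} (\<lambda>z.
    if zk_verify Z (param (left z)) (crs (left z)) (left (right z), pkI (left z)) (right (right z))
    then bind_pmf (daa_issue D (param (left z)) (skI (left z)) (left (right z))) (\<lambda>cred. return_pmf (Node Leaf cred))
    else return_pmf Leaf)"
    by (intro ptime_bind ptime_if_bool algorithm_intros det_intros) auto
  then show ?thesis
    by (rule ptime_cong) (simp add: issue_data_def tt_issue_def
      map_bind_pmf bind_assoc_pmf bind_return_pmf Let_def)
qed

section \<open>The oracles on association lists\<close>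

definition corrupt_user_data :: "data \<Rightarrow> data \<Rightarrow> data pmf" where
  "corrupt_user_data q st = return_pmf (Node (get (key 1 q) st) (put (key 0 q) Leaf st))"

definition corrupt_ver_data :: "data \<Rightarrow> data \<Rightarrow> data pmf" where
  "corrupt_ver_data q st = (if q = Leaf then return_pmf (Node Leaf st)
     else return_pmf (Node Leaf (put (key 2 q) Leaf st)))"

definition create_honest_user_data :: "data \<Rightarrow> data \<Rightarrow> data pmf" where
  "create_honest_user_data q st =
     (if q \<noteq> Leaf \<and> get (key 0 (left q)) st = Leaf \<and> get (key 1 (left q)) st = Leaf
      then bind_pmf (join_issue_data (left st)) (\<lambda>r.
        if r = Leaf then return_pmf (Node Leaf (put (key 2 q) Leaf st))
        else return_pmf (Node (Node Leaf Leaf) (put (key 1 (left q)) (right r) (put (key 2 q) Leaf st))))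
      else return_pmf (Node Leaf st))"

definition join_system_data :: "data \<Rightarrow> data \<Rightarrow> data pmf" where
  "join_system_data q st =
     (if q \<noteq> Leaf \<and> right q \<noteq> Leaf \<and> right (right q) \<noteq> Leaf \<and>
        get (key 0 (left q)) st = Leaf \<and> get (key 1 (left q)) st = Leaf \<and>
        get (key 2 (Node (left q) (left (right q)))) st \<noteq> Leaf \<and> get (key 3 (left q)) st = Leaf
      then bind_pmf (issue_data (left st) (right (right q))) (\<lambda>r.
        if r = Leaf then return_pmf (Node Leaf st)
        else return_pmf (Node r (put (key 3 (left q)) Leaf st)))
      else return_pmf (Node Leaf st))"

definition create_comment_data :: "data \<Rightarrow> data \<Rightarrow> data pmf" where
  "create_comment_data q st =
     (if q \<noteq> Leaf \<and> right q \<noteq> Leaf \<and>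
        get (key 0 (left q)) st = Leaf \<and> get (key 1 (left q)) st \<noteq> Leaf
      then let sk = left (right (get (key 1 (left q)) st)); cred = right (right (get (key 1 (left q)) st));
          bsn = left (right q); m = right (right q); \<eta> = param (left st);
          nym = nym_gen D \<eta> sk bsn
        in bind_pmf (daa_sign D \<eta> sk cred bsn (h \<eta> m)) (\<lambda>\<sigma>.
          let \<gamma> = Node \<sigma> (Node nym (Node bsn (h \<eta> m)))
          in return_pmf (Node (Node Leaf (Node \<gamma> nym)) (put (key 4 \<gamma>) m st)))
      else return_pmf (Node Leaf st))"

primrec answer_data :: "query_name \<Rightarrow> data \<Rightarrow> data \<Rightarrow> data pmf" where
  "answer_data CorruptUser = corrupt_user_data"
| "answer_data CorruptVer = corrupt_ver_data"
| "answer_data CreateHonestUser = create_honest_user_data"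
| "answer_data JoinSystem = join_system_data"
| "answer_data CreateComment = create_comment_data"

abbreviation valid_query :: "data set" where
  "valid_query \<equiv> {x. left (left (right x)) \<in> range (enc :: nat \<Rightarrow> data)}"

lemma ptime_answer_data: "ptime valid_query (\<lambda>x. answer_data i (left x) (right x))"
proof (cases i)
  case CorruptUser
  show ?thesis
    unfolding CorruptUser answer_data.simps corrupt_user_data_def get_def put_def key_def
    by (intro det_intros)
next
  case CorruptVer
  show ?thesis
    unfolding CorruptVer answer_data.simps corrupt_ver_data_def get_def put_def key_def
    by (intro ptime_if_bool det_intros)
next
  case CreateHonestUser
  show ?thesis
    unfolding CreateHonestUser answer_data.simps create_honest_user_data_def get_def put_def key_def
    by (intro ptime_bind ptime_if_bool det_comp[OF _ ptime_join_issue_data] det_intros) auto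
next
  case JoinSystem
  have *: "ptime valid_query (\<lambda>x. issue_data (left (right x)) (right (right (left x))))"
    using det_comp[OF det_Node ptime_issue_data, of valid_query "\<lambda>x. left (right x)" "\<lambda>x. right (right (left x))"]
    by (simp add: det_intros)
  show ?thesis
    unfolding JoinSystem answer_data.simps join_system_data_def get_def put_def key_def
    by (intro ptime_bind ptime_if_bool ptime_subset[OF *] det_intros) auto
next
  case CreateComment
  show ?thesis
    unfolding CreateComment answer_data.simps create_comment_data_def get_def put_def key_def Let_def
    by (intro ptime_bind ptime_if_bool algorithm_intros det_intros) auto
qed

text \<open>If the same \<open>\<gamma>\<close> is created for several messages, only the last one
  is stored. Hence the last clause only asks that the stored message belong to some tuple with
  \<open>\<gamma>\<close>; the clause before it records that \<open>\<gamma>\<close> contains the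
  basename and the hash of the message of every such tuple.\<close>

definition represents :: "nat \<Rightarrow> data \<Rightarrow> state \<Rightarrow> data \<Rightarrow> bool" where
  "represents \<eta> env s st \<longleftrightarrow> left st = env \<and>
     (\<forall>U. U \<in> CU s \<longleftrightarrow> get (key 0 U) st \<noteq> Leaf) \<and>
     (\<forall>U. get (key 1 U) st = enc (map_option (\<lambda>(skU, credU, V). (skU, credU)) (USK s U))) \<and>
     HU s = {U. USK s U \<noteq> None} - CU s \<and>
     (\<forall>U V. ver s V U \<longleftrightarrow> get (key 2 (Node U V)) st \<noteq> Leaf) \<and>
     (\<forall>U. U \<in> REG s \<longleftrightarrow> get (key 3 U) st \<noteq> Leaf) \<and>
     (\<forall>(U, nym, bsn, m, \<gamma>) \<in> COMM s. get (key 4 \<gamma>) st \<noteq> Leaf \<and> (\<exists>\<sigma> :: data. \<gamma> = enc (\<sigma>, nym, bsn, h \<eta> m))) \<and>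
     (\<forall>\<gamma>. get (key 4 \<gamma>) st \<noteq> Leaf \<longrightarrow> (\<exists>U nym bsn. (U, nym, bsn, right (get (key 4 \<gamma>) st), \<gamma>) \<in> COMM s))"

lemma represents_init: "represents \<eta> env init_state (Node env Leaf)"
  by (simp add: represents_def init_state_def get_def)

lemma represents_comment:
  assumes rep: "represents \<eta> env s st" and \<gamma>: "\<gamma> = enc (\<sigma> :: data, nym, bsn, h \<eta> m)"
  shows "represents \<eta> env (s\<lparr>COMM := insert (U, nym, bsn, m, \<gamma>) (COMM s)\<rparr>) (put (key 4 \<gamma>) m st)"
proof -
  let ?st = "put (key 4 \<gamma>) m st" and ?C = "insert (U, nym, bsn, m, \<gamma>) (COMM s)"
  have get: "get (key n d) ?st = get (key n d) st" if "n \<noteq> 4" for n d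
    using that by simp
  have 1: "\<forall>(U, nym, bsn, m, \<gamma>') \<in> COMM s. get (key 4 \<gamma>') st \<noteq> Leaf \<and> (\<exists>\<sigma> :: data. \<gamma>' = enc (\<sigma>, nym, bsn, h \<eta> m))"
    and 2: "\<forall>\<gamma>'. get (key 4 \<gamma>') st \<noteq> Leaf \<longrightarrow> (\<exists>U nym bsn. (U, nym, bsn, right (get (key 4 \<gamma>') st), \<gamma>') \<in> COMM s)"
    using rep by (simp_all add: represents_def)
  have "\<forall>(U, nym, bsn, m, \<gamma>') \<in> ?C. get (key 4 \<gamma>') ?st \<noteq> Leaf \<and> (\<exists>\<sigma> :: data. \<gamma>' = enc (\<sigma>, nym, bsn, h \<eta> m))"
  proof (intro ballI)
    fix c assume "c \<in> ?C"
    then show "case c of (U, nym, bsn, m, \<gamma>') \<Rightarrow> get (key 4 \<gamma>') ?st \<noteq> Leaf \<and> (\<exists>\<sigma> :: data. \<gamma>' = enc (\<sigma>, nym, bsn, h \<eta> m))"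
      using 1 \<gamma> by (cases "c \<in> COMM s") auto
  qed
  moreover have "\<exists>U nym bsn. (U, nym, bsn, right (get (key 4 \<gamma>') ?st), \<gamma>') \<in> ?C" if "get (key 4 \<gamma>') ?st \<noteq> Leaf" for \<gamma>'
  proof (cases "\<gamma>' = \<gamma>")
    case False
    then show ?thesis using 2 that by auto
  qed auto
  ultimately show ?thesis
    using rep by (simp add: represents_def)
qed

lemma enc_option_Leaf [simp]: "enc x = Leaf \<longleftrightarrow> x = None"
  by (cases x) auto

text \<open>Apart from the keys and credentials of new honest users, whatever an oracle adds to the
  state is visible in the query or the answer, hence paid for by the adversary's time up to a
  constant. Those keys and credentials are not part of the answer at creation, so their size needs
  the separate bound \<open>J\<close>.\<close>

lemma answer_data_correct:
  fixes \<eta> :: nat and \<rho> pk sk :: data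
  defines "env \<equiv> Node (enc \<eta>) (Node \<rho> (Node pk sk))"
  assumes rep: "represents \<eta> env s st"
    and J: "\<And>r. r \<in> set_pmf (join_issue_data env) \<Longrightarrow> size r \<le> J"
  shows "rel_pmf (\<lambda>(y, s') z. \<exists>st'. z = Node y st' \<and> represents \<eta> env s' st' \<and>
      size st' \<le> size st + (J + 100) * (cost q + size y))
    (answer D Z h (\<eta>, \<rho>) pk (pk, sk) i q s) (answer_data i q st)"
proof -
  let ?R = "\<lambda>(y, s') z. \<exists>st'. z = Node y st' \<and> represents \<eta> env s' st' \<and>
      size st' \<le> size st + (J + 100) * (cost q + size y)"
  have RI: "?R (y, s') (Node y st')"
    if "represents \<eta> env s' st'" "size st' \<le> size st + J + 100 * (cost q + size y)" for y s' st'
  proof -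
    have "J \<le> J * (cost q + size y)" by simp
    with that show ?thesis by (simp add: distrib_right)
  qed
  have env: "left st = env" using rep by (simp add: represents_def)
  have unchanged: "?R (y, s) (Node y st)" for y
    using RI[OF rep] by simp
  show ?thesis
  proof (cases i)
    case CorruptUser
    have "?R (get (key 1 q) st, snd (corrupt_user q s)) (Node (get (key 1 q) st) (put (key 0 q) Leaf st))"
    proof (rule RI)
      show "represents \<eta> env (snd (corrupt_user q s)) (put (key 0 q) Leaf st)"
        using rep by (auto simp: represents_def corrupt_user_def)
    qed (use size_put[of "key 0 q" Leaf st] in simp)
    moreover have "get (key 1 q) st = enc (fst (corrupt_user q s))"
      using rep by (simp add: represents_def corrupt_user_def)
    then have "answer D Z h (\<eta>, \<rho>) pk (pk, sk) i q s = return_pmf (get (key 1 q) st, snd (corrupt_user q s))"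
      by (simp add: CorruptUser answer_def map_prod_def case_prod_unfold)
    ultimately show ?thesis
      by (simp add: CorruptUser corrupt_user_data_def)
  next
    case CorruptVer
    show ?thesis
    proof (cases q)
      case Leaf
      then show ?thesis using unchanged by (simp add: CorruptVer answer_def corrupt_ver_data_def)
    next
      case (Node U V)
      have "?R (Leaf, corrupt_ver U V s) (Node Leaf (put (key 2 q) Leaf st))"
      proof (rule RI)
        show "represents \<eta> env (corrupt_ver U V s) (put (key 2 q) Leaf st)"
          using rep by (auto simp: represents_def corrupt_ver_def set_ver_def Node)
      qed (use size_put[of "key 2 q" Leaf st] in simp)
      then show ?thesis by (simp add: CorruptVer answer_def corrupt_ver_data_def Node)
    qed
  next
    case CreateHonestUser
    show ?thesis
    proof (cases q)
      case Leaf
      then show ?thesis using unchanged by (simp add: CreateHonestUser answer_def create_honest_user_data_def)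
    next
      case (Node U V)
      have cond: "U \<in> HU s \<union> CU s \<longleftrightarrow> \<not> (get (key 0 U) st = Leaf \<and> get (key 1 U) st = Leaf)"
        using rep by (auto simp: represents_def)
      show ?thesis
      proof (cases "U \<in> HU s \<union> CU s")
        case True
        with cond unchanged show ?thesis
          by (auto simp: CreateHonestUser answer_def create_honest_user_data_def create_honest_user_def Node)
      next
        case False
        let ?st = "put (key 2 q) Leaf st"
        have size_st: "size ?st \<le> size st + size q + 6"
          using size_put[of "key 2 q" Leaf st] by simp
        have rep': "represents \<eta> env (set_ver V U s) ?st"
          using rep by (auto simp: represents_def set_ver_def Node)
        have "rel_pmf ?R
          (bind_pmf (tt_join_issue D Z (\<eta>, \<rho>) pk (pk, sk)) (\<lambda>res. return_pmf (map_prod enc id (case res of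
            None \<Rightarrow> (None, set_ver V U s)
          | Some (skU, credU) \<Rightarrow> (Some (), (set_ver V U s)\<lparr>USK := (USK (set_ver V U s))(U \<mapsto> (skU, credU, V)),
              HU := insert U (HU (set_ver V U s))\<rparr>)))))
          (bind_pmf (tt_join_issue D Z (\<eta>, \<rho>) pk (pk, sk)) (\<lambda>res.
            if enc res = Leaf then return_pmf (Node Leaf ?st)
            else return_pmf (Node (Node Leaf Leaf) (put (key 1 U) (right (enc res)) ?st))))"
        proof (rule rel_pmf_bind_reflI)
          fix res assume res: "res \<in> set_pmf (tt_join_issue D Z (\<eta>, \<rho>) pk (pk, sk))"
          have J': "size (enc res) \<le> J"
            by (rule J) (use res in \<open>simp add: join_issue_data_def env_def\<close>)
          show "rel_pmf ?R (return_pmf (map_prod enc id (case res of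
            None \<Rightarrow> (None, set_ver V U s)
          | Some (skU, credU) \<Rightarrow> (Some (), (set_ver V U s)\<lparr>USK := (USK (set_ver V U s))(U \<mapsto> (skU, credU, V)),
              HU := insert U (HU (set_ver V U s))\<rparr>))))
            (if enc res = Leaf then return_pmf (Node Leaf ?st)
            else return_pmf (Node (Node Leaf Leaf) (put (key 1 U) (right (enc res)) ?st)))"
          proof (cases res)
            case None
            have "?R (Leaf, set_ver V U s) (Node Leaf ?st)"
              by (rule RI[OF rep']) (use size_st in simp)
            then show ?thesis by (simp add: None)
          next
            case (Some r)
            obtain skU credU where r: "r = (skU, credU)" by (cases r)
            let ?s = "(set_ver V U s)\<lparr>USK := (USK (set_ver V U s))(U \<mapsto> (skU, credU, V)),
              HU := insert U (HU (set_ver V U s))\<rparr>"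
            have "?R (Node Leaf Leaf, ?s) (Node (Node Leaf Leaf) (put (key 1 U) (Node skU credU) ?st))"
            proof (rule RI)
              show "represents \<eta> env ?s (put (key 1 U) (Node skU credU) ?st)"
                using rep' False by (auto simp: represents_def set_ver_def)
              show "size (put (key 1 U) (Node skU credU) ?st) \<le> size st + J + 100 * (cost q + size (Node Leaf Leaf))"
                using size_put[of "key 1 U" "Node skU credU" ?st] size_st J' by (simp add: Some r Node)
            qed
            then show ?thesis by (simp add: Some r enc_unit_def)
          qed
        qed
        moreover have "answer D Z h (\<eta>, \<rho>) pk (pk, sk) i q s =
          bind_pmf (tt_join_issue D Z (\<eta>, \<rho>) pk (pk, sk)) (\<lambda>res. return_pmf (map_prod enc id (case res of
            None \<Rightarrow> (None, set_ver V U s)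
          | Some (skU, credU) \<Rightarrow> (Some (), (set_ver V U s)\<lparr>USK := (USK (set_ver V U s))(U \<mapsto> (skU, credU, V)),
              HU := insert U (HU (set_ver V U s))\<rparr>))))"
          using False by (simp add: CreateHonestUser answer_def create_honest_user_def Node map_bind_pmf Let_def)
        moreover have "answer_data i q st = bind_pmf (tt_join_issue D Z (\<eta>, \<rho>) pk (pk, sk)) (\<lambda>res.
            if enc res = Leaf then return_pmf (Node Leaf ?st)
            else return_pmf (Node (Node Leaf Leaf) (put (key 1 U) (right (enc res)) ?st)))"
          using False cond env
          by (simp add: CreateHonestUser create_honest_user_data_def Node join_issue_data_def env_def bind_map_pmf cong: if_cong)
        ultimately show ?thesis by (simp only:)
      qed
    qed
  next
    case JoinSystem
    show ?thesis
    proof (cases "\<exists>U V com \<pi>. q = Node U (Node V (Node com \<pi>))")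
      case False
      then have "answer D Z h (\<eta>, \<rho>) pk (pk, sk) i q s = return_pmf (Leaf, s)"
        "answer_data i q st = return_pmf (Node Leaf st)"
        by (auto simp: JoinSystem answer_def join_system_data_def split: data.split)
          (metis left.cases right.simps)+
      with unchanged show ?thesis by simp
    next
      case True
      then obtain U V com \<pi> where q: "q = Node U (Node V (Node com \<pi>))" by blast
      have cond: "U \<notin> HU s \<union> CU s \<and> ver s V U \<and> U \<notin> REG s \<longleftrightarrow>
          get (key 0 U) st = Leaf \<and> get (key 1 U) st = Leaf \<and> get (key 2 (Node U V)) st \<noteq> Leaf \<and> get (key 3 U) st = Leaf"
        using rep by (auto simp: represents_def)
      have "rel_pmf ?R
        (bind_pmf (tt_issue D Z (\<eta>, \<rho>) (pk, sk) (com, \<pi>)) (\<lambda>res. return_pmf (map_prod enc id (case res of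
            None \<Rightarrow> (None, s)
          | Some cred \<Rightarrow> (Some cred, s\<lparr>REG := insert U (REG s)\<rparr>)))))
        (bind_pmf (tt_issue D Z (\<eta>, \<rho>) (pk, sk) (com, \<pi>)) (\<lambda>res.
            if enc res = Leaf then return_pmf (Node Leaf st)
            else return_pmf (Node (enc res) (put (key 3 U) Leaf st))))"
      proof (rule rel_pmf_bind_reflI)
        fix res :: "data option"
        have "?R (enc res, s\<lparr>REG := insert U (REG s)\<rparr>) (Node (enc res) (put (key 3 U) Leaf st))"
        proof (rule RI)
          show "represents \<eta> env (s\<lparr>REG := insert U (REG s)\<rparr>) (put (key 3 U) Leaf st)"
            using rep by (auto simp: represents_def)
        qed (use size_put[of "key 3 U" Leaf st] q in simp)
        then show "rel_pmf ?R (return_pmf (map_prod enc id (case res of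
            None \<Rightarrow> (None, s)
          | Some cred \<Rightarrow> (Some cred, s\<lparr>REG := insert U (REG s)\<rparr>))))
          (if enc res = Leaf then return_pmf (Node Leaf st)
            else return_pmf (Node (enc res) (put (key 3 U) Leaf st)))"
          using unchanged by (cases res) auto
      qed
      note rel = this
      show ?thesis
      proof (cases "U \<notin> HU s \<union> CU s \<and> ver s V U \<and> U \<notin> REG s")
        case True
        have "answer D Z h (\<eta>, \<rho>) pk (pk, sk) i q s =
          bind_pmf (tt_issue D Z (\<eta>, \<rho>) (pk, sk) (com, \<pi>)) (\<lambda>res. return_pmf (map_prod enc id (case res of
            None \<Rightarrow> (None, s)
          | Some cred \<Rightarrow> (Some cred, s\<lparr>REG := insert U (REG s)\<rparr>))))"
          using True by (simp add: JoinSystem answer_def join_system_def q map_bind_pmf)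
        moreover have "answer_data i q st = bind_pmf (tt_issue D Z (\<eta>, \<rho>) (pk, sk) (com, \<pi>)) (\<lambda>res.
            if enc res = Leaf then return_pmf (Node Leaf st)
            else return_pmf (Node (enc res) (put (key 3 U) Leaf st)))"
          using True[unfolded cond] env
          by (simp add: JoinSystem join_system_data_def q issue_data_def env_def bind_map_pmf cong: if_cong)
        ultimately show ?thesis using rel by (simp only:)
      next
        case False
        have "answer D Z h (\<eta>, \<rho>) pk (pk, sk) i q s = return_pmf (Leaf, s)"
          using False by (auto simp: JoinSystem answer_def join_system_def q)
        moreover have "answer_data i q st = return_pmf (Node Leaf st)"
          using False[unfolded cond] by (auto simp: JoinSystem join_system_data_def q)
        ultimately show ?thesis using unchanged by simp
      qed
    qed
  next
    case CreateComment
    show ?thesis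
    proof (cases "\<exists>U bsn m. q = Node U (Node bsn m)")
      case False
      then have "answer D Z h (\<eta>, \<rho>) pk (pk, sk) i q s = return_pmf (Leaf, s)"
        "answer_data i q st = return_pmf (Node Leaf st)"
        by (auto simp: CreateComment answer_def create_comment_data_def split: data.split)
          (metis left.cases right.simps)+
      with unchanged show ?thesis by simp
    next
      case True
      then obtain U bsn m where q: "q = Node U (Node bsn m)" by blast
      have HU: "U \<in> HU s \<longleftrightarrow> get (key 0 U) st = Leaf \<and> get (key 1 U) st \<noteq> Leaf"
        and USK: "get (key 1 U) st = enc (map_option (\<lambda>(skU, credU, V). (skU, credU)) (USK s U))"
        using rep by (auto simp: represents_def)
      show ?thesis
      proof (cases "U \<in> HU s")
        case False
        with HU unchanged show ?thesis
          by (auto simp: CreateComment answer_def create_comment_data_def create_comment_def q)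
      next
        case True
        then obtain skU credU V where sk: "USK s U = Some (skU, credU, V)"
          using HU USK by (cases "USK s U") auto
        let ?nym = "nym_gen D \<eta> skU bsn"
        let ?\<gamma> = "\<lambda>\<sigma>. Node \<sigma> (Node ?nym (Node bsn (h \<eta> m)))"
        have "rel_pmf ?R
          (bind_pmf (daa_sign D \<eta> skU credU bsn (h \<eta> m)) (\<lambda>\<sigma>. return_pmf (Node Leaf (Node (?\<gamma> \<sigma>) ?nym),
             s\<lparr>COMM := insert (U, ?nym, bsn, m, ?\<gamma> \<sigma>) (COMM s)\<rparr>)))
          (bind_pmf (daa_sign D \<eta> skU credU bsn (h \<eta> m)) (\<lambda>\<sigma>. return_pmf (Node (Node Leaf (Node (?\<gamma> \<sigma>) ?nym))
             (put (key 4 (?\<gamma> \<sigma>)) m st))))"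
        proof (rule rel_pmf_bind_reflI)
          fix \<sigma>
          have "?R (Node Leaf (Node (?\<gamma> \<sigma>) ?nym), s\<lparr>COMM := insert (U, ?nym, bsn, m, ?\<gamma> \<sigma>) (COMM s)\<rparr>)
             (Node (Node Leaf (Node (?\<gamma> \<sigma>) ?nym)) (put (key 4 (?\<gamma> \<sigma>)) m st))"
          proof (rule RI)
            show "represents \<eta> env (s\<lparr>COMM := insert (U, ?nym, bsn, m, ?\<gamma> \<sigma>) (COMM s)\<rparr>) (put (key 4 (?\<gamma> \<sigma>)) m st)"
              by (rule represents_comment[OF rep]) simp
          qed (use size_put[of "key 4 (?\<gamma> \<sigma>)" m st] q in simp)
          then show "rel_pmf ?R (return_pmf (Node Leaf (Node (?\<gamma> \<sigma>) ?nym),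
             s\<lparr>COMM := insert (U, ?nym, bsn, m, ?\<gamma> \<sigma>) (COMM s)\<rparr>))
             (return_pmf (Node (Node Leaf (Node (?\<gamma> \<sigma>) ?nym)) (put (key 4 (?\<gamma> \<sigma>)) m st)))"
            by simp
        qed
        then show ?thesis
          using True HU USK env
          by (simp add: CreateComment answer_def create_comment_data_def create_comment_def tt_comment_def q sk
            map_bind_pmf bind_assoc_pmf bind_return_pmf Let_def env_def)
      qed
    qed
  qed
qed

end

section \<open>The collision finder\<close>

lemma bind_spmf_bind_pmf: "bind_spmf (bind_pmf p f) g = bind_pmf p (\<lambda>x. bind_spmf (f x) g)"
  by (simp add: bind_spmf_def bind_assoc_pmf)

lemma sim_bind_refl:
  assumes "\<And>x. x \<in> set_spmf p \<Longrightarrow> sim S (f x) (g x)"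
  shows "sim S (bind_spmf p f) (bind_spmf p g)"
proof (rule sim_bind)
  show "sim (\<lambda>x y. x = y \<and> x \<in> set_spmf p) p p"
    by (rule rel_spmf_imp_sim) (auto intro: rel_spmf_reflI)
qed (use assms in auto)

lemma computes_imp_sim:
  assumes "rel_pmf R D E" "computes P x E T"
  shows "sim (\<lambda>a (z, t). R a z \<and> t \<le> T) (spmf_of_pmf D) (exec P x)"
proof (rule rel_spmf_imp_sim)
  have "rel_spmf R (spmf_of_pmf D) (map_spmf fst (exec P x))"
    using assms by (simp add: computes_def)
  then have "rel_spmf (\<lambda>a b. R a (fst b)) (spmf_of_pmf D) (exec P x)"
    by (simp add: spmf_rel_map)
  then show "rel_spmf (\<lambda>a (z, t). R a z \<and> t \<le> T) (spmf_of_pmf D) (exec P x)"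
    by (rule rel_spmf_mono_strong) (use assms(2) in \<open>auto simp: computes_def\<close>)
qed

text \<open>By losslessness \<open>None\<close> has probability zero, so \<open>the\<close> turns
  the \<open>spmf\<close> into the required \<open>pmf\<close>.\<close>

lemma lossless_exec_computes:
  assumes "lossless_spmf (exec P x)" "\<And>y t. (y, t) \<in> set_spmf (exec P x) \<Longrightarrow> t \<le> T"
  shows "computes P x (map_pmf (\<lambda>r. fst (the r)) (exec P x)) T"
proof -
  have "spmf_of_pmf (map_pmf (\<lambda>r. fst (the r)) (exec P x)) = map_spmf fst (exec P x)"
    unfolding spmf_of_pmf_def map_pmf_comp
  proof (intro map_pmf_cong refl)
    fix r assume "r \<in> set_pmf (exec P x)"
    then show "Some (fst (the r)) = map_option fst r"
      using assms(1) by (cases r) (auto simp: lossless_iff_set_pmf_None)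
  qed
  then show ?thesis using assms(2) by (auto simp: computes_def)
qed

context trollthrottle
begin

section \<open>The compiled adversary in the experiment\<close>

definition setting :: "nat \<Rightarrow> data \<Rightarrow> data \<Rightarrow> data \<Rightarrow> data" where
  "setting \<eta> \<rho> pk sk = Node (enc ((\<eta>, \<rho>), pk)) (Node (Node (enc \<eta>) (Node \<rho> (Node pk sk))) Leaf)"

definition settings :: "data set" where
  "settings = {setting \<eta> \<rho> pk sk | \<eta> \<rho> pk sk. \<rho> \<in> set_pmf (zk_setup Z \<eta>) \<and> (pk, sk) \<in> set_pmf (daa_setup D \<eta>)}"

text \<open>One program serves all security parameters; only the constants \<open>c\<close>,
  \<open>m\<close> and \<open>G\<close> of its analysis depend on the input, as values of
  polynomials at its size \<open>n\<close>.\<close>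

lemma adversary_simulation:
  assumes "ppt_adversary D Z h A"
  obtains f where "ptime settings f"
    and "\<And>\<eta> \<rho> pk sk. \<rho> \<in> set_pmf (zk_setup Z \<eta>) \<Longrightarrow> (pk, sk) \<in> set_pmf (daa_setup D \<eta>) \<Longrightarrow>
      sim (\<lambda>(y, s, t) z. \<exists>st. z = Node y st \<and> represents \<eta> (Node (enc \<eta>) (Node \<rho> (Node pk sk))) s st)
        (run_adversary D Z h A (\<eta>, \<rho>) pk (pk, sk)) (spmf_of_pmf (f (setting \<eta> \<rho> pk sk)))"
proof -
  from assms obtain pA :: "nat poly" where pA: "\<And>\<eta> \<rho> pk sk. \<rho> \<in> set_pmf (zk_setup Z \<eta>) \<Longrightarrow>
      (pk, sk) \<in> set_pmf (daa_setup D \<eta>) \<Longrightarrow> lossless_spmf (run_adversary D Z h A (\<eta>, \<rho>) pk (pk, sk)) \<and>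
       (\<forall>(out, s, t) \<in> set_spmf (run_adversary D Z h A (\<eta>, \<rho>) pk (pk, sk)). t \<le> poly pA \<eta>)"
    unfolding ppt_adversary_def tt_setup_def tt_keygen_def by fastforce
  have "\<forall>i. \<exists>P p. \<forall>x \<in> valid_query. computes P x (answer_data i (left x) (right x)) (poly p (size x))"
    using ptime_answer_data unfolding ptime_def by blast
  then obtain Or p where Or: "\<And>i x. x \<in> valid_query \<Longrightarrow>
      computes (Or i) x (answer_data i (left x) (right x)) (poly (p i) (size x))"
    by metis
  define pO where "pO = p CorruptUser + p CorruptVer + p CreateHonestUser + p JoinSystem + p CreateComment"
  have pO: "poly (p i) n \<le> poly pO n" for i n
    by (cases i) (simp_all add: pO_def)
  obtain pJ where pJ: "\<And>x y. x \<in> {e. left e \<in> range (enc :: nat \<Rightarrow> data)} \<Longrightarrow>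
      y \<in> set_pmf (join_issue_data x) \<Longrightarrow> size y \<le> poly pJ (size x)"
    using ptime_size[OF ptime_join_issue_data] by blast
  \<comment> \<open>Here \<open>pJ\<close> accounts for stored keys and credentials, and
    \<open>100\<close> for all other growth; \<open>pm\<close> bounds the initial state plus its
    growth within time \<open>pA\<close>; \<open>pG\<close> adds the plumbing to the time of an
    oracle on data of size \<open>pm\<close>, with \<open>+ 1\<close> for the node that pairs query
    and state.\<close>
  define pc where "pc = pJ + [:100:]"
  define pm where "pm = [:0, 1:] + pc * pA"
  define pG where "pG = smult 1000 (pm + 1) + pcompose pO (pm + 1)"
  let ?f = "\<lambda>w. map_pmf (\<lambda>r. fst (the r)) (exec (compile Or A) w)"
  have *: "computes (compile Or A) w (?f w) (poly (pA * pG) (size w)) \<and>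
      sim (\<lambda>(y, s, t) z. \<exists>st. z = Node y st \<and> represents \<eta> (Node (enc \<eta>) (Node \<rho> (Node pk sk))) s st)
        (run_adversary D Z h A (\<eta>, \<rho>) pk (pk, sk)) (spmf_of_pmf (?f w))"
    if valid: "\<rho> \<in> set_pmf (zk_setup Z \<eta>)" "(pk, sk) \<in> set_pmf (daa_setup D \<eta>)" and w: "w = setting \<eta> \<rho> pk sk"
    for \<eta> \<rho> pk sk w
  proof -
    define env where "env = Node (enc \<eta>) (Node \<rho> (Node pk sk))"
    define n where "n = size w"
    have w': "w = Node (enc ((\<eta>, \<rho>), pk)) (Node env Leaf)" by (simp add: w setting_def env_def)
    have size_env: "size env < n" "\<eta> \<le> n" by (simp_all add: n_def w' env_def)
    interpret simulation "answer D Z h (\<eta>, \<rho>) pk (pk, sk)" Or "represents \<eta> env" "poly pc n" "poly pm n" "poly pG n"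
    proof
      show "1 \<le> poly pc n" by (simp add: pc_def)
      show "1000 * (poly pm n + 1) \<le> poly pG n" by (simp add: pG_def poly_pcompose)
      fix s st i x
      assume rep: "represents \<eta> env s st"
      have J: "size r \<le> poly pJ n" if "r \<in> set_pmf (join_issue_data env)" for r
        using pJ[OF _ that] poly_nat_mono[of "size env" n pJ] size_env by (force simp: env_def)
      have "computes (Or i) (Node x st) (answer_data i x st) (poly pO (size (Node x st)))"
        using computes_mono[OF Or pO, of "Node x st" i] rep by (simp add: represents_def env_def)
      then have "sim (\<lambda>a (z, t). (case a of (y, s') \<Rightarrow> \<lambda>z. \<exists>st'. z = Node y st' \<and> represents \<eta> env s' st' \<and>
            size st' \<le> size st + (poly pJ n + 100) * (cost x + size y)) z \<and> t \<le> poly pO (size (Node x st)))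
          (spmf_of_pmf (answer D Z h (\<eta>, \<rho>) pk (pk, sk) i x s)) (exec (Or i) (Node x st))"
        by (intro computes_imp_sim) (use answer_data_correct[where \<eta>=\<eta> and \<rho>=\<rho> and pk=pk and sk=sk and s=s and st=st and J="poly pJ n" and q=x and i=i] rep J in \<open>simp_all add: env_def\<close>)
      moreover have "poly pO (size (Node x st)) \<le> poly pG n" if "size x + size st \<le> poly pm n"
        using poly_nat_mono[of "size (Node x st)" "poly pm n + 1" pO] that by (simp add: pG_def poly_pcompose)
      ultimately show "sim (\<lambda>(y, s') (z, t'). \<exists>st'. z = Node y st' \<and> represents \<eta> env s' st' \<and>
          size st' \<le> size st + poly pc n * (cost x + size y) \<and> (poly pm n < size x + size st \<or> t' \<le> poly pG n))
        (spmf_of_pmf (answer D Z h (\<eta>, \<rho>) pk (pk, sk) i x s)) (exec (Or i) (Node x st))"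
        by (elim sim_mono) (auto simp: pc_def not_less dest: order.trans)
    qed
    let ?run = "run_adversary D Z h A (\<eta>, \<rho>) pk (pk, sk)"
    have sim: "sim (\<lambda>a b. rel (Node env Leaf) a b \<and> a \<in> set_spmf ?run) ?run (exec (compile Or A) w)"
      by (rule sim_restrict[OF simulation[OF represents_init, where x="enc ((\<eta>, \<rho>), pk)" and P=A, folded run_adversary_def w']])
        simp
    have lossless: "lossless_spmf (exec (compile Or A) w)"
      using sim_lossless(1)[OF sim] pA[OF valid] by blast
    \<comment> \<open>Losslessness relates this outcome to one of the adversary in the experiment,
      whose time is at most \<open>pA\<close>. So the potential size stays within \<open>pm\<close>,
      and the conditional bound applies.\<close>
    have time: "t' \<le> poly (pA * pG) n" if mem: "(z, t') \<in> set_spmf (exec (compile Or A) w)" for z t'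
    proof -
      obtain y s t where a: "rel (Node env Leaf) (y, s, t) (z, t')" "(y, s, t) \<in> set_spmf ?run"
        using sim_lossless(2)[OF sim _ mem] pA[OF valid] by fastforce
      have "t \<le> poly pA \<eta>" using pA[OF valid] a(2) by fastforce
      also have "\<dots> \<le> poly pA n" by (rule poly_nat_mono) (rule size_env(2))
      finally have t: "t \<le> poly pA n" .
      then have "poly pc n * t \<le> poly pc n * poly pA n" by simp
      moreover have "poly pm n = n + poly pc n * poly pA n" "size (Node env Leaf) = size env + 1"
        by (simp_all add: pm_def)
      ultimately have "size (Node env Leaf) + poly pc n * t \<le> poly pm n"
        using size_env(1) by linarith
      with a(1) have "t' \<le> t * poly pG n" by fastforce
      also have "\<dots> \<le> poly pA n * poly pG n" using t by simp
      finally show ?thesis by simp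
    qed
    have c: "computes (compile Or A) w (?f w) (poly (pA * pG) (size w))"
      by (rule lossless_exec_computes[OF lossless]) (use time in \<open>simp add: n_def\<close>)
    have "sim (\<lambda>(y, s, t) z. \<exists>st. z = Node y st \<and> represents \<eta> env s st) (bind_spmf ?run return_spmf)
        (bind_spmf (exec (compile Or A) w) (\<lambda>(z, t). return_spmf z))"
      by (rule sim_bind[OF sim]) (auto intro!: sim_return)
    also have "bind_spmf (exec (compile Or A) w) (\<lambda>(z, t). return_spmf z) = spmf_of_pmf (?f w)"
      using c by (simp add: computes_def map_spmf_conv_bind_spmf case_prod_unfold)
    finally show ?thesis using c by (simp add: env_def)
  qed
  show thesis
  proof (rule that)
    show "ptime settings ?f"
      unfolding ptime_def settings_def using * by blast
  qed (use * in blast)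
qed

text \<open>For \<open>z = Node y st\<close> with a well-formed output \<open>y\<close>, these are
  the message stored for the claimed comment and the claimed message.\<close>

definition candidate :: "data \<Rightarrow> data" where
  "candidate z = Node (right (get (key 4 (left (right (right (left z))))) (right z))) (left (right (left z)))"

text \<open>The stored message may stem from another tuple than the one witnessing the win. This
  does no harm: all tuples with \<open>\<gamma>\<close> share its basename and hash value, and
  freshness excludes the claimed pair from the whole of \<open>COMM\<close>.\<close>

lemma win_imp_collision:
  assumes rep: "represents \<eta> env s st" and win: "accsound_win D h (\<eta>, \<rho>) pk s y"
  shows "left (candidate (Node y st)) \<noteq> right (candidate (Node y st)) \<and>
    h \<eta> (left (candidate (Node y st))) = h \<eta> (right (candidate (Node y st)))"
proof -
  from win obtain bsn m \<gamma> ev where y: "y = enc (bsn, m, \<gamma>, ev)"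
    and fresh: "\<And>U nym \<gamma>'. (U, nym, bsn, m, \<gamma>') \<notin> COMM s"
    and old: "\<exists>U nym bsn' m'. (U, nym, bsn', m', \<gamma>) \<in> COMM s"
    and verify: "tt_verify_claim D h (\<eta>, \<rho>) pk bsn m \<gamma> ev"
    unfolding accsound_win_def by blast
  from verify obtain \<sigma> nym where \<gamma>: "\<gamma> = enc (\<sigma> :: data, nym :: data, bsn, h \<eta> m)"
    by (auto simp: tt_verify_claim_def tt_verify_def)
  let ?m = "right (get (key 4 \<gamma>) st)"
  have "get (key 4 \<gamma>) st \<noteq> Leaf"
    using rep old by (fastforce simp: represents_def)
  then obtain U nym' bsn' where comm: "(U, nym', bsn', ?m, \<gamma>) \<in> COMM s"
    using rep by (fastforce simp: represents_def)
  then obtain \<sigma>' where "\<gamma> = enc (\<sigma>' :: data, nym', bsn', h \<eta> ?m)"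
    using rep by (fastforce simp: represents_def)
  with \<gamma> have "bsn' = bsn" "h \<eta> ?m = h \<eta> m" by auto
  with comm fresh show ?thesis by (auto simp: candidate_def y)
qed

lemma accsound_negligible:
  assumes cr: "collision_resistant h" and A: "ppt_adversary D Z h A"
  shows "negligible_fun (\<lambda>\<eta>. spmf (accsound_exp D Z h A \<eta>) True)"
proof -
  obtain f where f: "ptime settings f"
    and sim_f: "\<And>\<eta> \<rho> pk sk. \<rho> \<in> set_pmf (zk_setup Z \<eta>) \<Longrightarrow> (pk, sk) \<in> set_pmf (daa_setup D \<eta>) \<Longrightarrow>
      sim (\<lambda>(y, s, t) z. \<exists>st. z = Node y st \<and> represents \<eta> (Node (enc \<eta>) (Node \<rho> (Node pk sk))) s st)
        (run_adversary D Z h A (\<eta>, \<rho>) pk (pk, sk)) (spmf_of_pmf (f (setting \<eta> \<rho> pk sk)))"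
    using adversary_simulation[OF A] by blast
  \<comment> \<open>\<open>F\<close> is the collision finder on trees, where the rules for
    \<open>ptime\<close> apply, and \<open>B\<close> its typed version; \<open>left x\<close> is the
    unary security parameter.\<close>
  define F where "F x = bind_pmf (zk_setup Z (num (left x))) (\<lambda>\<rho>.
      bind_pmf (map_pmf enc (daa_setup D (num (left x)))) (\<lambda>k.
      bind_pmf (f (setting (num (left x)) \<rho> (left k) (right k))) (\<lambda>z. return_pmf (candidate z))))" for x
  define B :: "nat \<Rightarrow> unit \<Rightarrow> (data \<times> data) pmf" where
    "B \<eta> u = map_pmf (\<lambda>z. (left z, right z)) (F (enc (\<eta>, u)))" for \<eta> u
  let ?X = "range (enc :: nat \<times> unit \<Rightarrow> data)"
  have zk: "ptime Y (\<lambda>x. zk_setup Z (num (N x)))" if "ptime_det Y N" "N ` Y \<subseteq> range (enc :: nat \<Rightarrow> data)" for Y N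
    using ptime_ppt[of "\<lambda>\<eta> (_ :: unit). zk_setup Z \<eta>" Y "\<lambda>x. num (N x)" "\<lambda>_. ()"] pok that
    by (simp add: proof_of_knowledge_def det_Node det_const det_enc_num)
  have issuer: "ptime Y (\<lambda>x. map_pmf enc (daa_setup D (num (N x))))" if "ptime_det Y N" "N ` Y \<subseteq> range (enc :: nat \<Rightarrow> data)" for Y N
    using ptime_ppt[of "\<lambda>\<eta> (_ :: unit). daa_setup D \<eta>" Y "\<lambda>x. num (N x)" "\<lambda>_. ()"] daa that
    by (simp add: is_daa_def det_Node det_const det_enc_num)
  have "ptime ?X F"
    unfolding F_def
    by (intro ptime_bind zk issuer det_intros det_comp[OF _ f])
      (auto simp: candidate_def get_def key_def setting_def settings_def intro!: det_enc_num det_intros)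
  then have "ppt B"
    by (rule ptime_imp_ppt) (simp add: B_def map_pmf_comp F_def candidate_def map_bind_pmf)
  let ?C = "\<lambda>\<eta>. {(m, m'). m \<noteq> m' \<and> h \<eta> m = h \<eta> m'}"
  have le: "spmf (accsound_exp D Z h A \<eta>) True \<le> measure_pmf.prob (B \<eta> ()) (?C \<eta>)" for \<eta>
  proof -
    \<comment> \<open>An implication suffices as relation, since the probability of winning is only
      bounded from above. Both sides share setup and key generation.\<close>
    have "sim (\<lambda>b z. b \<longrightarrow> (left z, right z) \<in> ?C \<eta>) (accsound_exp D Z h A \<eta>) (spmf_of_pmf (F (enc (\<eta>, ()))))"
    proof -
      let ?S = "\<lambda>b z. b \<longrightarrow> (left z, right z) \<in> ?C \<eta>"
      have "sim ?S
        (bind_spmf (spmf_of_pmf (zk_setup Z \<eta>)) (\<lambda>\<rho>. bind_spmf (spmf_of_pmf (daa_setup D \<eta>)) (\<lambda>(pk, sk).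
          bind_spmf (run_adversary D Z h A (\<eta>, \<rho>) pk (pk, sk)) (\<lambda>(y, s, t).
            return_spmf (accsound_win D h (\<eta>, \<rho>) pk s y)))))
        (bind_spmf (spmf_of_pmf (zk_setup Z \<eta>)) (\<lambda>\<rho>. bind_spmf (spmf_of_pmf (daa_setup D \<eta>)) (\<lambda>(pk, sk).
          bind_spmf (spmf_of_pmf (f (setting \<eta> \<rho> pk sk))) (\<lambda>z. return_spmf (candidate z)))))"
      proof (rule sim_bind_refl)
        fix \<rho> assume \<rho>: "\<rho> \<in> set_spmf (spmf_of_pmf (zk_setup Z \<eta>))"
        show "sim ?S (bind_spmf (spmf_of_pmf (daa_setup D \<eta>)) (\<lambda>(pk, sk).
          bind_spmf (run_adversary D Z h A (\<eta>, \<rho>) pk (pk, sk)) (\<lambda>(y, s, t).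
            return_spmf (accsound_win D h (\<eta>, \<rho>) pk s y))))
        (bind_spmf (spmf_of_pmf (daa_setup D \<eta>)) (\<lambda>(pk, sk).
          bind_spmf (spmf_of_pmf (f (setting \<eta> \<rho> pk sk))) (\<lambda>z. return_spmf (candidate z))))"
        proof (rule sim_bind_refl)
          fix k assume k: "k \<in> set_spmf (spmf_of_pmf (daa_setup D \<eta>))"
          obtain pk sk where pksk: "k = (pk, sk)" by (cases k)
          have "sim ?S (bind_spmf (run_adversary D Z h A (\<eta>, \<rho>) pk (pk, sk)) (\<lambda>(y, s, t).
              return_spmf (accsound_win D h (\<eta>, \<rho>) pk s y)))
            (bind_spmf (spmf_of_pmf (f (setting \<eta> \<rho> pk sk))) (\<lambda>z. return_spmf (candidate z)))"
            by (rule sim_bind[OF sim_f])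
              (use \<rho> k pksk win_imp_collision in \<open>auto intro!: sim_return\<close>)
          then show "sim ?S (case k of (pk, sk) \<Rightarrow>
              bind_spmf (run_adversary D Z h A (\<eta>, \<rho>) pk (pk, sk)) (\<lambda>(y, s, t).
                return_spmf (accsound_win D h (\<eta>, \<rho>) pk s y)))
            (case k of (pk, sk) \<Rightarrow>
              bind_spmf (spmf_of_pmf (f (setting \<eta> \<rho> pk sk))) (\<lambda>z. return_spmf (candidate z)))"
            by (simp add: pksk)
        qed
      qed
      then show ?thesis
        by (simp add: accsound_exp_def tt_setup_def tt_keygen_def F_def spmf_of_pmf_bind bind_map_pmf
          case_prod_unfold enc_prod_def bind_spmf_bind_pmf)
    qed
    then have "measure (measure_spmf (accsound_exp D Z h A \<eta>)) {True} \<le>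
        measure (measure_spmf (spmf_of_pmf (F (enc (\<eta>, ()))))) {z. (left z, right z) \<in> ?C \<eta>}"
      by (rule sim_measure) auto
    also have "\<dots> = measure_pmf.prob (B \<eta> ()) (?C \<eta>)"
      by (simp add: B_def vimage_def)
    finally show ?thesis by (simp add: spmf_conv_measure_spmf)
  qed
  from cr \<open>ppt B\<close> have "negligible_fun (\<lambda>\<eta>. measure_pmf.prob (B \<eta> ()) (?C \<eta>))"
    by (simp add: collision_resistant_def)
  then show ?thesis
    unfolding negligible_fun_def
    by (intro allI; elim allE eventually_mono) (use le in \<open>auto intro: order_trans simp: pmf_nonneg\<close>)
qed

end

theorem theorem11:
  fixes D :: daa and Z :: nizk and h :: "nat \<Rightarrow> data \<Rightarrow> data"
  assumes "collision_resistant h"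
    and "is_daa D"
    and "instantly_linkable D"
    and "proof_of_knowledge Z (R_join D)"
  shows "\<forall>A :: query_name prog. ppt_adversary D Z h A \<longrightarrow>
           negligible_fun (\<lambda>\<eta>. spmf (accsound_exp D Z h A \<eta>) True)"
proof -
  interpret trollthrottle D Z h
    using assms by unfold_locales (simp_all add: collision_resistant_def)
  show ?thesis
    using accsound_negligible[OF assms(1)] by blast
qed

end
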